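(* Let $(M,\varphi,\xi,\eta,g)$ be a $(2n+1)$-dimensional almost contact B-metric manifold with a regular torse-forming constant-length vertical vector field $\vartheta$ with conformal scalar $f$ and constant $k$ of proportionality to $\xi$. Let $$h:=\tfrac12\mathcal L_\vartheta g+\rho+\mu\,\tilde g+\nu\,\eta\otimes\eta,$$ where $\mu$ and $\nu$ are differentiable functions on $M$. Then the following conditions are equivalent: (i) $h$ is parallel with respect to the Levi-Civita connection $\nabla$ of $g$; (ii) $M$ admits an almost Ricci-like soliton with potential $\vartheta$ and functions $(\lambda,\mu,\nu)$, where $\lambda$ is a constant, such that $$\lambda+\mu+\nu=\frac{2n}{k^2}\left\{k\,\mathrm{d}f(\xi)+f^2\right\};$$ (iii) $M$ is almost Einstein-like with functions $(a,b,c)$ such that $$a+b+c=-\frac{2n}{k^2}\left\{k\,\mathrm{d}f(\xi)+f^2\right\}.$$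
   Context: An almost contact B-metric manifold $(M,\varphi,\xi,\eta,g)$ is a smooth manifold $M$ of dimension $2n+1$ ($n\ge 1$) with an endomorphism $\varphi$ of $TM$, a vector field $\xi$ (the Reeb vector field), a 1-form $\eta$, and a pseudo-Riemannian metric $g$ of signature $(n+1,n)$ such that $$\varphi\xi=0,\quad \varphi^2=-\mathrm{id}+\eta\otimes\xi,\quad \eta\circ\varphi=0,\quad \eta(\xi)=1,\quad g(\varphi x,\varphi y)=-g(x,y)+\eta(x)\eta(y)$$ for all $x,y$. The associated metric is $\tilde g(x,y)=g(x,\varphi y)+\eta(x)\eta(y)$. $\nabla$ is the Levi-Civita connection of $g$, $\rho$ is the Ricci tensor of $g$ (with $R(x,y)z=\nabla_x\nabla_yz-\nabla_y\nabla_xz-\nabla_{[x,y]}z$ and $\rho(y,z)=\mathrm{tr}\,(x\mapsto R(x,y)z)$), and $\mathcal L$ is the Lie derivative. A vector field $\vartheta$ is torse-forming if $\nabla_x\vartheta=f\,x+\gamma(x)\vartheta$ for all $x$, where $f$ is a differentiable function (the conformal scalar) and $\gamma$ is a 1-form (the generating form). The trivial case $f=0$ (identically) is excluded. It is constant-length vertical if $\vartheta=k\,\xi$ with $k$ a nonzero constant (the constant of proportionality to $\xi$). A torse-forming constant-length vertical vector field $\vartheta$ is regular if $k\,\mathrm{d}f(\xi)+f^2\neq0$ (at every point of $M$). $M$ admits an almost Ricci-like soliton with potential $\vartheta$ and functions $(\lambda,\mu,\nu)$ on $M$ if $$\tfrac12\mathcal L_\vartheta g+\rho+\lambda\,g+\mu\,\tilde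 g+\nu\,\eta\otimes\eta=0.$$ $M$ is almost Einstein-like with functions $(a,b,c)$ on $M$ if $\rho=a\,g+b\,\tilde g+c\,\eta\otimes\eta$.
   Formalization: M is assumed connected (otherwise λ need not be one constant), and in (iii) the functions are required to be a = −λ−f, b = −μ, c = f−ν for some constant λ; with unrelated (a,b,c), (iii) does not imply (i) or (ii). *)

theory Defs
  imports "HOL-Analysis.Analysis"
begin

section \<open>Smooth maps between Euclidean spaces\<close>

text \<open>For open \<open>S\<close>: all iterated directional derivatives of order up to \<open>k\<close> exist and are
  continuous on \<open>S\<close>.\<close>

primrec Ck_on :: "nat \<Rightarrow> ('a::euclidean_space \<Rightarrow> 'b::real_normed_vector) \<Rightarrow> 'a set \<Rightarrow> bool" where
  "Ck_on 0 f S \<longleftrightarrow> continuous_on S f"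
| "Ck_on (Suc k) f S \<longleftrightarrow>
     (\<forall>x\<in>S. f differentiable (at x)) \<and> (\<forall>v. Ck_on k (\<lambda>x. frechet_derivative f (at x) v) S)"

definition smooth_on :: "('a::euclidean_space \<Rightarrow> 'b::real_normed_vector) \<Rightarrow> 'a set \<Rightarrow> bool" where
  "smooth_on f S \<longleftrightarrow> (\<forall>k. Ck_on k f S)"


section \<open>Smooth manifolds\<close>

text \<open>The manifold is a whole Hausdorff, second countable type \<open>'m\<close>; a chart is an open set together
  with a coordinate map into \<open>real ^ 'd\<close> (the values of that map outside the set are irrelevant).\<close>

type_synonym ('m, 'd) chart = "'m set \<times> ('m \<Rightarrow> real ^ 'd)"

definition chart_inv :: "('m, 'd) chart \<Rightarrow> real ^ 'd \<Rightarrow> 'm" where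
  "chart_inv c = inv_into (fst c) (snd c)"

definition smooth_atlas ::
  "('m::{t2_space, second_countable_topology}, 'd::finite) chart set \<Rightarrow> bool" where
  "smooth_atlas A \<longleftrightarrow>
     (\<forall>c\<in>A. open (fst c) \<and> open (snd c ` fst c) \<and>
            homeomorphism (fst c) (snd c ` fst c) (snd c) (chart_inv c)) \<and>
     (\<Union>c\<in>A. fst c) = UNIV \<and>
     (\<forall>c\<in>A. \<forall>d\<in>A. smooth_on (snd d \<circ> chart_inv c) (snd c ` (fst c \<inter> fst d)))"

definition chart_at :: "('m, 'd) chart set \<Rightarrow> 'm \<Rightarrow> ('m, 'd) chart" where
  "chart_at A p = (SOME c. c \<in> A \<and> p \<in> fst c)"

text \<open>The tangent space at \<open>p\<close> is identified with \<open>real ^ 'd\<close> by means of the differential of the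
  preferred chart \<open>chart_at A p\<close>. Hence a vector field is a map \<open>'m \<Rightarrow> real ^ 'd\<close>, and a tensor
  field assigns to each point a multilinear map on \<open>real ^ 'd\<close>. Since the preferred chart jumps
  from point to point, smoothness of a vector field is not smoothness of this map: it is expressed
  through the components in a fixed chart, given by \<open>components\<close>.\<close>

definition components ::
  "('m, 'd::finite) chart set \<Rightarrow> ('m, 'd) chart \<Rightarrow> 'm \<Rightarrow> real ^ 'd \<Rightarrow> real ^ 'd" where
  "components A c p v =
     frechet_derivative (snd c \<circ> chart_inv (chart_at A p)) (at (snd (chart_at A p) p)) v"

definition smooth_fun_on :: "('m, 'd::finite) chart set \<Rightarrow> 'm set \<Rightarrow> ('m \<Rightarrow> real) \<Rightarrow> bool" where
  "smooth_fun_on A U f \<longleftrightarrow> (\<forall>c\<in>A. smooth_on (f \<circ> chart_inv c) (snd c ` (fst c \<inter> U)))"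

definition smooth_vf_on :: "('m, 'd::finite) chart set \<Rightarrow> 'm set \<Rightarrow> ('m \<Rightarrow> real ^ 'd) \<Rightarrow> bool" where
  "smooth_vf_on A U X \<longleftrightarrow>
     (\<forall>c\<in>A. smooth_on (\<lambda>x. components A c (chart_inv c x) (X (chart_inv c x)))
                      (snd c ` (fst c \<inter> U)))"

text \<open>\<open>vec_fields A U\<close> is the space of smooth vector fields on the open set \<open>U\<close>.\<close>

definition vec_fields :: "('m::topological_space, 'd::finite) chart set \<Rightarrow> 'm set \<Rightarrow> ('m \<Rightarrow> real ^ 'd) set" where
  "vec_fields A U = {X. open U \<and> smooth_vf_on A U X}"

text \<open>\<open>differential A f p v\<close> is \<open>df(v)\<close> for a tangent vector \<open>v\<close> at \<open>p\<close>.\<close>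

definition differential ::
  "('m, 'd::finite) chart set \<Rightarrow> ('m \<Rightarrow> real) \<Rightarrow> 'm \<Rightarrow> real ^ 'd \<Rightarrow> real" where
  "differential A f p v =
     frechet_derivative (f \<circ> chart_inv (chart_at A p)) (at (snd (chart_at A p) p)) v"

text \<open>\<open>[X,Y]\<close> is the vector field with \<open>[X,Y]f = X(Yf) - Y(Xf)\<close> for all \<open>f\<close> smooth near the point.\<close>

definition lie_bracket ::
  "('m::topological_space, 'd::finite) chart set \<Rightarrow> ('m \<Rightarrow> real ^ 'd) \<Rightarrow> ('m \<Rightarrow> real ^ 'd) \<Rightarrow> 'm \<Rightarrow> real ^ 'd" where
  "lie_bracket A X Y p =
     (THE v. \<forall>U f. open U \<longrightarrow> p \<in> U \<longrightarrow> smooth_fun_on A U f \<longrightarrow>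
        differential A f p v =
          differential A (\<lambda>q. differential A f q (Y q)) p (X p)
        - differential A (\<lambda>q. differential A f q (X q)) p (Y p))"


section \<open>Smooth tensor fields and pseudo-Riemannian metrics\<close>

definition smooth_one_form ::
  "('m::topological_space, 'd::finite) chart set \<Rightarrow> ('m \<Rightarrow> real ^ 'd \<Rightarrow> real) \<Rightarrow> bool" where
  "smooth_one_form A \<alpha> \<longleftrightarrow>
     (\<forall>p. linear (\<alpha> p)) \<and>
     (\<forall>U. \<forall>X\<in>vec_fields A U. smooth_fun_on A U (\<lambda>p. \<alpha> p (X p)))"

definition smooth_endomorphism ::
  "('m::topological_space, 'd::finite) chart set \<Rightarrow> ('m \<Rightarrow> real ^ 'd \<Rightarrow> real ^ 'd) \<Rightarrow> bool" where
  "smooth_endomorphism A \<phi> \<longleftrightarrow>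
     (\<forall>p. linear (\<phi> p)) \<and>
     (\<forall>U. \<forall>X\<in>vec_fields A U. smooth_vf_on A U (\<lambda>p. \<phi> p (X p)))"

definition smooth_bilinear ::
  "('m::topological_space, 'd::finite) chart set \<Rightarrow> ('m \<Rightarrow> real ^ 'd \<Rightarrow> real ^ 'd \<Rightarrow> real) \<Rightarrow> bool" where
  "smooth_bilinear A g \<longleftrightarrow>
     (\<forall>p. bilinear (g p)) \<and>
     (\<forall>U. \<forall>X\<in>vec_fields A U. \<forall>Y\<in>vec_fields A U. smooth_fun_on A U (\<lambda>p. g p (X p) (Y p)))"

text \<open>Signature \<open>(r, s)\<close>: \<open>r\<close> positive and \<open>s\<close> negative squares in an orthonormal basis.\<close>

definition has_signature :: "('v::euclidean_space \<Rightarrow> 'v \<Rightarrow> real) \<Rightarrow> nat \<Rightarrow> nat \<Rightarrow> bool" where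
  "has_signature B r s \<longleftrightarrow>
     (\<exists>e::nat \<Rightarrow> 'v.
        inj_on e {..<r + s} \<and> independent (e ` {..<r + s}) \<and> span (e ` {..<r + s}) = UNIV \<and>
        (\<forall>i<r + s. \<forall>j<r + s. B (e i) (e j) = (if i \<noteq> j then 0 else if i < r then 1 else -1)))"

definition pseudo_riemannian_metric ::
  "('m::topological_space, 'd::finite) chart set \<Rightarrow> nat \<Rightarrow> nat \<Rightarrow>
   ('m \<Rightarrow> real ^ 'd \<Rightarrow> real ^ 'd \<Rightarrow> real) \<Rightarrow> bool" where
  "pseudo_riemannian_metric A r s g \<longleftrightarrow>
     smooth_bilinear A g \<and> (\<forall>p x y. g p x y = g p y x) \<and> (\<forall>p. has_signature (g p) r s)"


section \<open>Connections, curvature, Lie derivative\<close>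

text \<open>\<open>D p v Y\<close> stands for the covariant derivative of \<open>Y\<close> at \<open>p\<close> in the direction \<open>v\<close>. The axioms
  are imposed for fields and functions that are smooth on an arbitrary open set, i.e. the connection
  is taken together with its restrictions to open subsets of the manifold. Values of \<open>D p v Y\<close> for
  \<open>Y\<close> not smooth near \<open>p\<close> are irrelevant.\<close>

definition affine_connection ::
  "('m::topological_space, 'd::finite) chart set \<Rightarrow>
   ('m \<Rightarrow> real ^ 'd \<Rightarrow> ('m \<Rightarrow> real ^ 'd) \<Rightarrow> real ^ 'd) \<Rightarrow> bool" where
  "affine_connection A D \<longleftrightarrow>
     (\<forall>U. \<forall>X\<in>vec_fields A U. \<forall>Y\<in>vec_fields A U. smooth_vf_on A U (\<lambda>p. D p (X p) Y)) \<and>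
     (\<forall>U. \<forall>Y\<in>vec_fields A U. \<forall>p\<in>U. linear (\<lambda>v. D p v Y)) \<and>
     (\<forall>U. \<forall>Y\<in>vec_fields A U. \<forall>Z\<in>vec_fields A U. \<forall>p\<in>U. \<forall>v.
        D p v (\<lambda>q. Y q + Z q) = D p v Y + D p v Z) \<and>
     (\<forall>U f. \<forall>Y\<in>vec_fields A U. smooth_fun_on A U f \<longrightarrow> (\<forall>p\<in>U. \<forall>v.
        D p v (\<lambda>q. f q *\<^sub>R Y q) = differential A f p v *\<^sub>R Y p + f p *\<^sub>R D p v Y))"

definition torsion_free ::
  "('m::topological_space, 'd::finite) chart set \<Rightarrow>
   ('m \<Rightarrow> real ^ 'd \<Rightarrow> ('m \<Rightarrow> real ^ 'd) \<Rightarrow> real ^ 'd) \<Rightarrow> bool" where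
  "torsion_free A D \<longleftrightarrow>
     (\<forall>U. \<forall>X\<in>vec_fields A U. \<forall>Y\<in>vec_fields A U. \<forall>p\<in>U.
        D p (X p) Y - D p (Y p) X = lie_bracket A X Y p)"

text \<open>\<open>(\<nabla>_v h)(Y p, Z p)\<close> for a field \<open>h\<close> of bilinear forms, evaluated on the fields \<open>Y\<close>, \<open>Z\<close>.\<close>

definition cov_deriv_bilinear ::
  "('m, 'd::finite) chart set \<Rightarrow> ('m \<Rightarrow> real ^ 'd \<Rightarrow> ('m \<Rightarrow> real ^ 'd) \<Rightarrow> real ^ 'd) \<Rightarrow>
   ('m \<Rightarrow> real ^ 'd \<Rightarrow> real ^ 'd \<Rightarrow> real) \<Rightarrow> 'm \<Rightarrow> real ^ 'd \<Rightarrow>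
   ('m \<Rightarrow> real ^ 'd) \<Rightarrow> ('m \<Rightarrow> real ^ 'd) \<Rightarrow> real" where
  "cov_deriv_bilinear A D h p v Y Z =
     differential A (\<lambda>q. h q (Y q) (Z q)) p v - h p (D p v Y) (Z p) - h p (Y p) (D p v Z)"

definition parallel ::
  "('m::topological_space, 'd::finite) chart set \<Rightarrow>
   ('m \<Rightarrow> real ^ 'd \<Rightarrow> ('m \<Rightarrow> real ^ 'd) \<Rightarrow> real ^ 'd) \<Rightarrow>
   ('m \<Rightarrow> real ^ 'd \<Rightarrow> real ^ 'd \<Rightarrow> real) \<Rightarrow> bool" where
  "parallel A D h \<longleftrightarrow>
     (\<forall>U. \<forall>Y\<in>vec_fields A U. \<forall>Z\<in>vec_fields A U. \<forall>p\<in>U. \<forall>v. cov_deriv_bilinear A D h p v Y Z = 0)"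

definition levi_civita ::
  "('m::topological_space, 'd::finite) chart set \<Rightarrow> ('m \<Rightarrow> real ^ 'd \<Rightarrow> real ^ 'd \<Rightarrow> real) \<Rightarrow>
   ('m \<Rightarrow> real ^ 'd \<Rightarrow> ('m \<Rightarrow> real ^ 'd) \<Rightarrow> real ^ 'd) \<Rightarrow> bool" where
  "levi_civita A g D \<longleftrightarrow> affine_connection A D \<and> torsion_free A D \<and> parallel A D g"

definition curvature ::
  "('m::topological_space, 'd::finite) chart set \<Rightarrow>
   ('m \<Rightarrow> real ^ 'd \<Rightarrow> ('m \<Rightarrow> real ^ 'd) \<Rightarrow> real ^ 'd) \<Rightarrow>
   ('m \<Rightarrow> real ^ 'd) \<Rightarrow> ('m \<Rightarrow> real ^ 'd) \<Rightarrow> ('m \<Rightarrow> real ^ 'd) \<Rightarrow> 'm \<Rightarrow> real ^ 'd" where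
  "curvature A D X Y Z p =
     D p (X p) (\<lambda>q. D q (Y q) Z) - D p (Y p) (\<lambda>q. D q (X q) Z) - D p (lie_bracket A X Y p) Z"

text \<open>By tensoriality the curvature at \<open>p\<close> depends only on the values of the three fields at \<open>p\<close>;
  \<open>curvature_at\<close> is the resulting trilinear map on the tangent space.\<close>

definition curvature_at ::
  "('m::topological_space, 'd::finite) chart set \<Rightarrow>
   ('m \<Rightarrow> real ^ 'd \<Rightarrow> ('m \<Rightarrow> real ^ 'd) \<Rightarrow> real ^ 'd) \<Rightarrow>
   'm \<Rightarrow> real ^ 'd \<Rightarrow> real ^ 'd \<Rightarrow> real ^ 'd \<Rightarrow> real ^ 'd" where
  "curvature_at A D p x y z =
     (THE r. \<forall>U. \<forall>X\<in>vec_fields A U. \<forall>Y\<in>vec_fields A U. \<forall>Z\<in>vec_fields A U.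
        p \<in> U \<and> X p = x \<and> Y p = y \<and> Z p = z \<longrightarrow> r = curvature A D X Y Z p)"

definition ricci ::
  "('m::topological_space, 'd::finite) chart set \<Rightarrow>
   ('m \<Rightarrow> real ^ 'd \<Rightarrow> ('m \<Rightarrow> real ^ 'd) \<Rightarrow> real ^ 'd) \<Rightarrow>
   'm \<Rightarrow> real ^ 'd \<Rightarrow> real ^ 'd \<Rightarrow> real" where
  "ricci A D p y z = trace (matrix (\<lambda>x. curvature_at A D p x y z))"

text \<open>\<open>(L_V B)(X,Y) = V(B(X,Y)) - B([V,X],Y) - B(X,[V,Y])\<close>, again as a bilinear form at \<open>p\<close>.\<close>

definition lie_derivative ::
  "('m::topological_space, 'd::finite) chart set \<Rightarrow> ('m \<Rightarrow> real ^ 'd) \<Rightarrow>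
   ('m \<Rightarrow> real ^ 'd \<Rightarrow> real ^ 'd \<Rightarrow> real) \<Rightarrow> 'm \<Rightarrow> real ^ 'd \<Rightarrow> real ^ 'd \<Rightarrow> real" where
  "lie_derivative A V B p x y =
     (THE r. \<forall>U. \<forall>X\<in>vec_fields A U. \<forall>Y\<in>vec_fields A U.
        p \<in> U \<and> X p = x \<and> Y p = y \<longrightarrow>
        r = differential A (\<lambda>q. B q (X q) (Y q)) p (V p)
            - B p (lie_bracket A V X p) (Y p) - B p (X p) (lie_bracket A V Y p))"


section \<open>Almost contact B-metric manifolds\<close>

definition almost_contact_B_metric_manifold ::
  "nat \<Rightarrow> ('m::{t2_space, second_countable_topology}, 'd::finite) chart set \<Rightarrow>
   ('m \<Rightarrow> real ^ 'd \<Rightarrow> real ^ 'd) \<Rightarrow> ('m \<Rightarrow> real ^ 'd) \<Rightarrow> ('m \<Rightarrow> real ^ 'd \<Rightarrow> real) \<Rightarrow>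
   ('m \<Rightarrow> real ^ 'd \<Rightarrow> real ^ 'd \<Rightarrow> real) \<Rightarrow> bool" where
  "almost_contact_B_metric_manifold n A \<phi> \<xi> \<eta> g \<longleftrightarrow>
     n \<ge> 1 \<and> CARD('d) = 2 * n + 1 \<and> smooth_atlas A \<and>
     smooth_endomorphism A \<phi> \<and> \<xi> \<in> vec_fields A UNIV \<and> smooth_one_form A \<eta> \<and>
     pseudo_riemannian_metric A (n + 1) n g \<and>
     (\<forall>p. \<phi> p (\<xi> p) = 0) \<and>
     (\<forall>p x. \<phi> p (\<phi> p x) = - x + \<eta> p x *\<^sub>R \<xi> p) \<and>
     (\<forall>p x. \<eta> p (\<phi> p x) = 0) \<and>
     (\<forall>p. \<eta> p (\<xi> p) = 1) \<and>
     (\<forall>p x y. g p (\<phi> p x) (\<phi> p y) = - g p x y + \<eta> p x * \<eta> p y)"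

definition associated_metric ::
  "('m \<Rightarrow> real ^ 'd \<Rightarrow> real ^ 'd) \<Rightarrow> ('m \<Rightarrow> real ^ 'd \<Rightarrow> real) \<Rightarrow>
   ('m \<Rightarrow> real ^ 'd \<Rightarrow> real ^ 'd \<Rightarrow> real) \<Rightarrow> 'm \<Rightarrow> real ^ 'd \<Rightarrow> real ^ 'd \<Rightarrow> real" where
  "associated_metric \<phi> \<eta> g p x y = g p x (\<phi> p y) + \<eta> p x * \<eta> p y"

definition torse_forming ::
  "('m::topological_space, 'd::finite) chart set \<Rightarrow>
   ('m \<Rightarrow> real ^ 'd \<Rightarrow> ('m \<Rightarrow> real ^ 'd) \<Rightarrow> real ^ 'd) \<Rightarrow>
   ('m \<Rightarrow> real ^ 'd) \<Rightarrow> ('m \<Rightarrow> real) \<Rightarrow> ('m \<Rightarrow> real ^ 'd \<Rightarrow> real) \<Rightarrow> bool" where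
  "torse_forming A D \<theta> f \<gamma> \<longleftrightarrow>
     \<theta> \<in> vec_fields A UNIV \<and> smooth_fun_on A UNIV f \<and> smooth_one_form A \<gamma> \<and>
     (\<forall>p x. D p x \<theta> = f p *\<^sub>R x + \<gamma> p x *\<^sub>R \<theta> p) \<and>
     \<not> (\<forall>p. f p = 0)"

definition constant_length_vertical ::
  "('m \<Rightarrow> real ^ 'd) \<Rightarrow> ('m \<Rightarrow> real ^ 'd) \<Rightarrow> real \<Rightarrow> bool" where
  "constant_length_vertical \<xi> \<theta> k \<longleftrightarrow> k \<noteq> 0 \<and> (\<forall>p. \<theta> p = k *\<^sub>R \<xi> p)"

definition regular ::
  "('m, 'd::finite) chart set \<Rightarrow> ('m \<Rightarrow> real ^ 'd) \<Rightarrow> ('m \<Rightarrow> real) \<Rightarrow> real \<Rightarrow> bool" where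
  "regular A \<xi> f k \<longleftrightarrow> (\<forall>p. k * differential A f p (\<xi> p) + (f p)\<^sup>2 \<noteq> 0)"

definition almost_ricci_like_soliton ::
  "('m::topological_space, 'd::finite) chart set \<Rightarrow>
   ('m \<Rightarrow> real ^ 'd \<Rightarrow> ('m \<Rightarrow> real ^ 'd) \<Rightarrow> real ^ 'd) \<Rightarrow>
   ('m \<Rightarrow> real ^ 'd \<Rightarrow> real ^ 'd) \<Rightarrow> ('m \<Rightarrow> real ^ 'd \<Rightarrow> real) \<Rightarrow>
   ('m \<Rightarrow> real ^ 'd \<Rightarrow> real ^ 'd \<Rightarrow> real) \<Rightarrow> ('m \<Rightarrow> real ^ 'd) \<Rightarrow>
   ('m \<Rightarrow> real) \<Rightarrow> ('m \<Rightarrow> real) \<Rightarrow> ('m \<Rightarrow> real) \<Rightarrow> bool" where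
  "almost_ricci_like_soliton A D \<phi> \<eta> g \<theta> l \<mu> \<nu> \<longleftrightarrow>
     (\<forall>p x y. (1 / 2) * lie_derivative A \<theta> g p x y + ricci A D p x y
        + l p * g p x y + \<mu> p * associated_metric \<phi> \<eta> g p x y + \<nu> p * (\<eta> p x * \<eta> p y) = 0)"

definition almost_einstein_like ::
  "('m::topological_space, 'd::finite) chart set \<Rightarrow>
   ('m \<Rightarrow> real ^ 'd \<Rightarrow> ('m \<Rightarrow> real ^ 'd) \<Rightarrow> real ^ 'd) \<Rightarrow>
   ('m \<Rightarrow> real ^ 'd \<Rightarrow> real ^ 'd) \<Rightarrow> ('m \<Rightarrow> real ^ 'd \<Rightarrow> real) \<Rightarrow>
   ('m \<Rightarrow> real ^ 'd \<Rightarrow> real ^ 'd \<Rightarrow> real) \<Rightarrow>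
   ('m \<Rightarrow> real) \<Rightarrow> ('m \<Rightarrow> real) \<Rightarrow> ('m \<Rightarrow> real) \<Rightarrow> bool" where
  "almost_einstein_like A D \<phi> \<eta> g a b c \<longleftrightarrow>
     (\<forall>p x y. ricci A D p x y =
        a p * g p x y + b p * associated_metric \<phi> \<eta> g p x y + c p * (\<eta> p x * \<eta> p y))"

text \<open>For a torse-forming \<open>\<theta> = k \<xi>\<close> with conformal scalar \<open>f\<close> one has
  \<open>(1/2) L_\<theta> g = f (g - \<eta> \<otimes> \<eta>)\<close>. So the soliton equation with functions \<open>(l, \<mu>, \<nu>)\<close> says exactly
  that the Ricci tensor has the Einstein-like form with the functions \<open>(- l - f, - \<mu>, f - \<nu>)\<close>.
  An Einstein-like form with unrelated functions does not imply that the tensor built from the given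
  \<open>\<mu>\<close> and \<open>\<nu>\<close> is parallel, which is why the correspondence has to be stated.\<close>

definition corresponding_functions ::
  "('m \<Rightarrow> real) \<Rightarrow> ('m \<Rightarrow> real) \<Rightarrow> ('m \<Rightarrow> real) \<Rightarrow> ('m \<Rightarrow> real) \<Rightarrow>
   ('m \<Rightarrow> real) \<Rightarrow> ('m \<Rightarrow> real) \<Rightarrow> ('m \<Rightarrow> real) \<Rightarrow> bool" where
  "corresponding_functions f l \<mu> \<nu> a b c \<longleftrightarrow>
     (\<forall>p. a p = - l p - f p \<and> b p = - \<mu> p \<and> c p = f p - \<nu> p)"

end

theory Submission
  imports Defs
begin

text \<open>Put \<open>F = f / k\<close> and \<open>P x = x - \<eta>(x) \<xi>\<close>. Since \<open>\<xi>\<close> has constant length, the torse-forming condition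
  becomes \<open>\<nabla>\<^sub>x \<xi> = F P x\<close> (\<open>connection_\<xi>\<close>). Two consequences reduce the theorem to a single statement.
  On the one hand \<open>(1/2) L\<^sub>\<theta> g = f (g - \<eta> \<otimes> \<eta>)\<close> (\<open>lie_derivative_\<theta>\<close>), so the soliton equation with a constant
  \<open>l\<close> and the Einstein-like equation with the corresponding functions both say \<open>h = - l g\<close>. On the other
  hand \<open>R(x,\<xi>)\<xi> = - (dF(\<xi>) + F\<^sup>2) P x\<close>, hence \<open>\<rho>(\<xi>,\<xi>) = - 2n (dF(\<xi>) + F\<^sup>2)\<close> (\<open>ricci_\<xi>_\<xi>\<close>), and the conditions
  on the sums of the functions are just the equation \<open>h = - l g\<close> evaluated on \<open>(\<xi>,\<xi>)\<close>. What remains is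
  that \<open>h\<close> is parallel exactly when it is a constant multiple of \<open>g\<close>.

  A constant multiple of \<open>g\<close> is parallel. For the converse (\<open>parallel_tensor_eq_scaled_metric\<close>), the
  function \<open>h(\<xi>,\<xi>)\<close> has differential \<open>2 F \<sigma>\<close> with \<open>\<sigma> = h(\<cdot>,\<xi>) - h(\<xi>,\<xi>) \<eta>\<close>. The integrability of this
  equation forces \<open>(dF(\<xi>) + F\<^sup>2) \<sigma> = 0\<close>, so \<open>\<sigma> = 0\<close> by regularity; thus \<open>h(\<xi>,\<xi>)\<close> is a constant \<open>a\<close> on the
  connected manifold, and \<open>h(\<cdot>,\<xi>) = a \<eta>\<close>. Differentiating the latter gives \<open>F (h - a g) = 0\<close>, and regularity
  excludes an exceptional behaviour at the zeros of \<open>F\<close>.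

  The converse differentiates \<open>h\<close> and uses its symmetry, so the Ricci tensor has to be known to be
  smooth and symmetric. The bracket, the pointwise curvature and the Lie derivative are given by
  definite descriptions; they are shown to be well defined by the symmetry of second derivatives
  and by the principle that an operator on vector fields that is linear over functions depends only
  on the value of the field at the point (\<open>tensorial_eq\<close>). Symmetry of the Ricci tensor then follows
  from the first Bianchi identity together with the skew symmetry of the curvature operators.\<close>

section \<open>Calculus of smooth maps\<close>

lemma Ck_on_subset: "Ck_on k f S \<Longrightarrow> T \<subseteq> S \<Longrightarrow> Ck_on k f T"
  by (induction k arbitrary: f) (auto intro: continuous_on_subset)

lemma Ck_on_cong:
  assumes "open S" "\<And>x. x \<in> S \<Longrightarrow> f x = g x"
  shows "Ck_on k f S \<longleftrightarrow> Ck_on k g S"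
  using assms(2)
proof (induction k arbitrary: f g)
  case 0
  then show ?case by (auto cong: continuous_on_cong)
next
  case (Suc k)
  have diff: "f differentiable at x \<longleftrightarrow> g differentiable at x" if "x \<in> S" for x
    unfolding differentiable_def
    using that assms(1) Suc.prems has_derivative_transform_within_open
    by (metis (no_types, opaque_lifting))
  have "Ck_on k (\<lambda>x. frechet_derivative f (at x) v) S \<longleftrightarrow> Ck_on k (\<lambda>x. frechet_derivative g (at x) v) S"
    if "\<forall>x\<in>S. f differentiable at x" for v
    using that assms(1) Suc.prems
    by (intro Suc.IH) (metis frechet_derivative_transform_within_open)
  with diff show ?case by auto
qed

text \<open>Differentiability is demanded at every level of \<open>Ck_on\<close>, continuity only at the last; this lemma
  recovers the missing continuity and makes the classes decreasing in the order.\<close>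
lemma Ck_on_SucD: "Ck_on (Suc k) f S \<Longrightarrow> Ck_on k f S"
proof (induction k arbitrary: f)
  case 0
  then show ?case
    by (auto intro!: continuous_at_imp_continuous_on differentiable_imp_continuous_within)
next
  case (Suc k)
  then show ?case by (metis Ck_on.simps(2))
qed

lemma Ck_on_const: "Ck_on k (\<lambda>x. c) S"
  by (induction k arbitrary: c) auto

lemma Ck_on_bounded_linear:
  assumes "bounded_linear L" "Ck_on k f S" "open S"
  shows "Ck_on k (\<lambda>x. L (f x)) S"
  using assms(2)
proof (induction k arbitrary: f)
  case 0
  then show ?case using assms(1) by (simp add: bounded_linear.continuous_on)
next
  case (Suc k)
  have d: "((\<lambda>x. L (f x)) has_derivative (\<lambda>v. L (frechet_derivative f (at x) v))) (at x)"
    if "x \<in> S" for x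
    using Suc.prems that assms(1)
    by (simp add: bounded_linear.has_derivative frechet_derivative_works)
  have "frechet_derivative (\<lambda>x. L (f x)) (at x) v = L (frechet_derivative f (at x) v)" if "x \<in> S" for x v
    by (simp add: d[OF that, THEN frechet_derivative_at, symmetric])
  then show ?case
    using d Suc assms(3) by (auto simp: differentiable_def cong: Ck_on_cong)
qed

lemma Ck_on_add:
  assumes "Ck_on k f S" "Ck_on k g S" "open S"
  shows "Ck_on k (\<lambda>x. f x + g x) S"
  using assms(1,2)
proof (induction k arbitrary: f g)
  case 0
  then show ?case by (simp add: continuous_on_add)
next
  case (Suc k)
  have d: "((\<lambda>x. f x + g x) has_derivative
             (\<lambda>v. frechet_derivative f (at x) v + frechet_derivative g (at x) v)) (at x)"
    if "x \<in> S" for x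
    using Suc.prems that by (simp add: has_derivative_add frechet_derivative_works)
  have "frechet_derivative (\<lambda>x. f x + g x) (at x) v
          = frechet_derivative f (at x) v + frechet_derivative g (at x) v" if "x \<in> S" for x v
    by (simp add: d[OF that, THEN frechet_derivative_at, symmetric])
  then show ?case
    using d Suc assms(3) by (auto simp: differentiable_def cong: Ck_on_cong)
qed

lemma Ck_on_sum:
  assumes "\<And>i. i \<in> I \<Longrightarrow> Ck_on k (f i) S" "open S"
  shows "Ck_on k (\<lambda>x. \<Sum>i\<in>I. f i x) S"
  using assms by (induction I rule: infinite_finite_induct) (auto intro: Ck_on_const Ck_on_add)

lemma Ck_on_bounded_bilinear:
  assumes "bounded_bilinear B" "Ck_on k f S" "Ck_on k g S" "open S"
  shows "Ck_on k (\<lambda>x. B (f x) (g x)) S"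
  using assms(2,3)
proof (induction k arbitrary: f g)
  case 0
  then show ?case using assms(1) by (simp add: bounded_bilinear.continuous_on)
next
  case (Suc k)
  have d: "((\<lambda>x. B (f x) (g x)) has_derivative
             (\<lambda>v. B (f x) (frechet_derivative g (at x) v) + B (frechet_derivative f (at x) v) (g x))) (at x)"
    if "x \<in> S" for x
    using Suc.prems that assms(1)
    by (simp add: bounded_bilinear.FDERIV frechet_derivative_works)
  have *: "frechet_derivative (\<lambda>x. B (f x) (g x)) (at x) v
          = B (f x) (frechet_derivative g (at x) v) + B (frechet_derivative f (at x) v) (g x)" if "x \<in> S" for x v
    by (simp add: d[OF that, THEN frechet_derivative_at, symmetric])
  have "Ck_on k (\<lambda>x. B (f x) (frechet_derivative g (at x) v) + B (frechet_derivative f (at x) v) (g x)) S" for v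
    using Suc.prems assms(4) Ck_on_SucD[OF Suc.prems(1)] Ck_on_SucD[OF Suc.prems(2)]
    by (intro Ck_on_add Suc.IH) auto
  then show ?case
    using d assms(4) * by (auto simp: differentiable_def cong: Ck_on_cong)
qed

lemma linear_eq_sum_Basis:
  fixes L :: "'a::euclidean_space \<Rightarrow> 'b::real_vector"
  assumes "linear L"
  shows "L x = (\<Sum>b\<in>Basis. (x \<bullet> b) *\<^sub>R L b)"
proof -
  have "L x = L (\<Sum>b\<in>Basis. (x \<bullet> b) *\<^sub>R b)" by (simp add: euclidean_representation)
  also have "\<dots> = (\<Sum>b\<in>Basis. (x \<bullet> b) *\<^sub>R L b)"
    by (simp add: linear_sum[OF assms] linear_scale[OF assms])
  finally show ?thesis .
qed

text \<open>In the chain rule the direction \<open>Df(x) v\<close> fed to \<open>Dg\<close> varies with the point, whereas \<open>Ck_on\<close> only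
  speaks about constant directions. Expanding \<open>Df(x) v\<close> in the standard basis reduces the derivative
  of the composition to products to which the induction hypothesis applies.\<close>
lemma Ck_on_compose:
  fixes f :: "'a::euclidean_space \<Rightarrow> 'b::euclidean_space" and g :: "'b \<Rightarrow> 'c::real_normed_vector"
  assumes "Ck_on k f S" "Ck_on k g T" "f ` S \<subseteq> T" "open S" "open T"
  shows "Ck_on k (\<lambda>x. g (f x)) S"
  using assms(1,2)
proof (induction k arbitrary: g)
  case 0
  then show ?case using assms(3) by (auto intro: continuous_on_compose2)
next
  case (Suc k)
  have dg: "(g has_derivative (frechet_derivative g (at (f x)))) (at (f x))" if "x \<in> S" for x
    using Suc.prems that assms(3) by (auto simp: frechet_derivative_works)
  have df: "(f has_derivative (frechet_derivative f (at x))) (at x)" if "x \<in> S" for x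
    using Suc.prems that by (auto simp: frechet_derivative_works)
  have d: "((\<lambda>x. g (f x)) has_derivative
            (\<lambda>v. frechet_derivative g (at (f x)) (frechet_derivative f (at x) v))) (at x)" if "x \<in> S" for x
    using has_derivative_compose[OF df dg] that by blast
  have *: "frechet_derivative (\<lambda>x. g (f x)) (at x) v =
     (\<Sum>b\<in>Basis. (frechet_derivative f (at x) v \<bullet> b) *\<^sub>R frechet_derivative g (at (f x)) b)" if "x \<in> S" for x v
    using d[OF that, THEN frechet_derivative_at, symmetric]
      linear_eq_sum_Basis[OF has_derivative_linear[OF dg[OF that]]] by metis
  have "Ck_on k (\<lambda>x. \<Sum>b\<in>Basis. (frechet_derivative f (at x) v \<bullet> b) *\<^sub>R frechet_derivative g (at (f x)) b) S" for v
    using Suc.prems assms(4) Ck_on_SucD[OF Suc.prems(1)]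
    by (intro Ck_on_sum Ck_on_bounded_bilinear[OF bounded_bilinear_scaleR]
          Ck_on_bounded_linear[OF bounded_linear_inner_left] Suc.IH) auto
  then show ?case
    using d assms(4) * by (auto simp: differentiable_def cong: Ck_on_cong)
qed

lemma smooth_on_subset: "smooth_on f S \<Longrightarrow> T \<subseteq> S \<Longrightarrow> smooth_on f T"
  by (auto simp: smooth_on_def intro: Ck_on_subset)

lemma smooth_on_cong:
  "open S \<Longrightarrow> (\<And>x. x \<in> S \<Longrightarrow> f x = g x) \<Longrightarrow> smooth_on f S \<longleftrightarrow> smooth_on g S"
  unfolding smooth_on_def using Ck_on_cong[of S f g] by blast

lemma smooth_on_const: "smooth_on (\<lambda>x. c) S"
  by (simp add: smooth_on_def Ck_on_const)

lemma smooth_on_bounded_linear: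
  "bounded_linear L \<Longrightarrow> smooth_on f S \<Longrightarrow> open S \<Longrightarrow> smooth_on (\<lambda>x. L (f x)) S"
  by (simp add: smooth_on_def Ck_on_bounded_linear)

lemma smooth_on_add:
  "smooth_on f S \<Longrightarrow> smooth_on g S \<Longrightarrow> open S \<Longrightarrow> smooth_on (\<lambda>x. f x + g x) S"
  by (simp add: smooth_on_def Ck_on_add)

lemma smooth_on_sum:
  "(\<And>i. i \<in> I \<Longrightarrow> smooth_on (f i) S) \<Longrightarrow> open S \<Longrightarrow> smooth_on (\<lambda>x. \<Sum>i\<in>I. f i x) S"
  by (simp add: smooth_on_def Ck_on_sum)

lemma smooth_on_bounded_bilinear:
  "bounded_bilinear B \<Longrightarrow> smooth_on f S \<Longrightarrow> smooth_on g S \<Longrightarrow> open S \<Longrightarrow> smooth_on (\<lambda>x. B (f x) (g x)) S"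
  by (simp add: smooth_on_def Ck_on_bounded_bilinear)

lemma smooth_on_compose:
  fixes f :: "'a::euclidean_space \<Rightarrow> 'b::euclidean_space" and g :: "'b \<Rightarrow> 'c::real_normed_vector"
  shows "smooth_on f S \<Longrightarrow> smooth_on g T \<Longrightarrow> f ` S \<subseteq> T \<Longrightarrow> open S \<Longrightarrow> open T
    \<Longrightarrow> smooth_on (\<lambda>x. g (f x)) S"
  unfolding smooth_on_def by (blast intro: Ck_on_compose)

lemma smooth_on_differentiable: "smooth_on f S \<Longrightarrow> x \<in> S \<Longrightarrow> f differentiable (at x)"
  unfolding smooth_on_def by (metis Ck_on.simps(2))

lemma smooth_on_has_derivative:
  "smooth_on f S \<Longrightarrow> x \<in> S \<Longrightarrow> (f has_derivative frechet_derivative f (at x)) (at x)"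
  using smooth_on_differentiable frechet_derivative_works by blast

lemma smooth_on_derivative:
  "smooth_on f S \<Longrightarrow> smooth_on (\<lambda>x. frechet_derivative f (at x) v) S"
  unfolding smooth_on_def by (metis Ck_on.simps(2))

lemma smooth_on_continuous: "smooth_on f S \<Longrightarrow> continuous_on S f"
  unfolding smooth_on_def by (metis Ck_on.simps(1))

text \<open>The expression of \<open>X f\<close> in a chart, for a vector field \<open>X\<close> with components \<open>V\<close>.\<close>
lemma smooth_on_directional_derivative:
  fixes f :: "'a::euclidean_space \<Rightarrow> 'b::real_normed_vector"
  assumes f: "smooth_on f S" and V: "smooth_on V S" and S: "open S"
  shows "smooth_on (\<lambda>x. frechet_derivative f (at x) (V x)) S"
proof -
  have "smooth_on (\<lambda>x. \<Sum>b\<in>Basis. (V x \<bullet> b) *\<^sub>R frechet_derivative f (at x) b) S"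
    using f V S
    by (intro smooth_on_sum smooth_on_bounded_bilinear[OF bounded_bilinear_scaleR]
          smooth_on_bounded_linear[OF bounded_linear_inner_left] smooth_on_derivative)
  moreover have "frechet_derivative f (at x) (V x) = (\<Sum>b\<in>Basis. (V x \<bullet> b) *\<^sub>R frechet_derivative f (at x) b)"
    if "x \<in> S" for x
    using linear_eq_sum_Basis linear_frechet_derivative smooth_on_differentiable[OF f that] by blast
  ultimately show ?thesis using smooth_on_cong[OF S] by (metis (no_types, lifting))
qed

section \<open>Symmetry of second derivatives\<close>

text \<open>The second difference over a parallelogram is symmetric in its two sides. Applying the mean value
  theorem in one direction and then in the other expresses it through either mixed derivative at
  some nearby point, which is the classical route to the symmetry of second derivatives.\<close>
lemma second_difference_mean_value:
  fixes f :: "'a::euclidean_space \<Rightarrow> real"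
  assumes f: "smooth_on f S" and t: "t > 0"
    and seg: "\<And>a b. 0 \<le> a \<Longrightarrow> a \<le> t \<Longrightarrow> 0 \<le> b \<Longrightarrow> b \<le> t \<Longrightarrow> x + a *\<^sub>R u + b *\<^sub>R v \<in> S"
  shows "\<exists>a b. 0 < a \<and> a < t \<and> 0 < b \<and> b < t \<and>
    f (x + t *\<^sub>R u + t *\<^sub>R v) - f (x + t *\<^sub>R u) - f (x + t *\<^sub>R v) + f x
     = t\<^sup>2 * frechet_derivative (\<lambda>y. frechet_derivative f (at y) u) (at (x + a *\<^sub>R u + b *\<^sub>R v)) v"
proof -
  define f1 where "f1 = (\<lambda>y. frechet_derivative f (at y) u)"
  have f1: "smooth_on f1 S" unfolding f1_def by (rule smooth_on_derivative[OF f])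
  have lin: "frechet_derivative f (at y) (s *\<^sub>R w) = s * frechet_derivative f (at y) w"
    "frechet_derivative f1 (at y) (s *\<^sub>R w) = s * frechet_derivative f1 (at y) w" if "y \<in> S" for s y w
    using linear_frechet_derivative[OF smooth_on_differentiable[OF f that]]
      linear_frechet_derivative[OF smooth_on_differentiable[OF f1 that]] by (simp_all add: linear_scale)
  define \<phi> where "\<phi> = (\<lambda>a. f (x + a *\<^sub>R u + t *\<^sub>R v) - f (x + a *\<^sub>R u + 0 *\<^sub>R v))"
  have der: "((\<lambda>a. f (x + a *\<^sub>R u + b *\<^sub>R v)) has_real_derivative f1 (x + a *\<^sub>R u + b *\<^sub>R v)) (at a)"
    if "0 \<le> a" "a \<le> t" "0 \<le> b" "b \<le> t" for a b
  proof -
    have "((\<lambda>a. x + a *\<^sub>R u + b *\<^sub>R v) has_derivative (\<lambda>h. h *\<^sub>R u)) (at a)"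
      by (auto intro!: derivative_eq_intros)
    from has_derivative_compose[OF this smooth_on_has_derivative[OF f seg[OF that]]]
    show ?thesis using lin(1)[OF seg[OF that]]
      by (simp add: has_field_derivative_def f1_def mult.commute[of _ "frechet_derivative _ _ _"])
  qed
  have "(\<phi> has_real_derivative (f1 (x + a *\<^sub>R u + t *\<^sub>R v) - f1 (x + a *\<^sub>R u + 0 *\<^sub>R v))) (at a)"
    if "0 \<le> a" "a \<le> t" for a
    unfolding \<phi>_def by (intro DERIV_diff der) (use that t in auto)
  from MVT2[OF t this] obtain a where a: "0 < a" "a < t"
    and 1: "\<phi> t - \<phi> 0 = t * (f1 (x + a *\<^sub>R u + t *\<^sub>R v) - f1 (x + a *\<^sub>R u + 0 *\<^sub>R v))" by auto
  have "((\<lambda>b. f1 (x + a *\<^sub>R u + b *\<^sub>R v)) has_real_derivative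
         frechet_derivative f1 (at (x + a *\<^sub>R u + b *\<^sub>R v)) v) (at b)"
    if "0 \<le> b" "b \<le> t" for b
  proof -
    have s: "x + a *\<^sub>R u + b *\<^sub>R v \<in> S" using a that by (auto intro: seg)
    have "((\<lambda>b. x + a *\<^sub>R u + b *\<^sub>R v) has_derivative (\<lambda>h. h *\<^sub>R v)) (at b)"
      by (auto intro!: derivative_eq_intros)
    from has_derivative_compose[OF this smooth_on_has_derivative[OF f1 s]]
    show ?thesis using lin(2)[OF s]
      by (simp add: has_field_derivative_def mult.commute[of _ "frechet_derivative _ _ _"])
  qed
  from MVT2[OF t this] obtain b where b: "0 < b" "b < t"
    and 2: "f1 (x + a *\<^sub>R u + t *\<^sub>R v) - f1 (x + a *\<^sub>R u + 0 *\<^sub>R v)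
             = t * frechet_derivative f1 (at (x + a *\<^sub>R u + b *\<^sub>R v)) v" by auto
  show ?thesis
    apply (rule exI[of _ a], rule exI[of _ b])
    using a b 1 2 by (simp add: \<phi>_def f1_def power2_eq_square)
qed

lemma symmetric_second_derivative:
  fixes f :: "'a::euclidean_space \<Rightarrow> real"
  assumes f: "smooth_on f S" and S: "open S" and x: "x \<in> S"
  shows "frechet_derivative (\<lambda>y. frechet_derivative f (at y) u) (at x) v
       = frechet_derivative (\<lambda>y. frechet_derivative f (at y) v) (at x) u"
proof (rule ccontr)
  define p where "p = (\<lambda>u v z. frechet_derivative (\<lambda>y. frechet_derivative f (at y) u) (at z) v)"
  assume "\<not> ?thesis"
  then have ne: "p u v x \<noteq> p v u x" by (simp add: p_def)
  define e where "e = \<bar>p u v x - p v u x\<bar> / 2"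
  have e: "e > 0" using ne by (simp add: e_def)
  have cont: "isCont (p u v) x" for u v
    using smooth_on_continuous[OF smooth_on_derivative[OF smooth_on_derivative[OF f]]] S x
    by (auto simp: p_def continuous_on_eq_continuous_at)
  obtain d1 where d1: "d1 > 0" "\<And>y. dist y x < d1 \<Longrightarrow> dist (p u v y) (p u v x) < e"
    using cont[of u v] e unfolding continuous_at_eps_delta by blast
  obtain d2 where d2: "d2 > 0" "\<And>y. dist y x < d2 \<Longrightarrow> dist (p v u y) (p v u x) < e"
    using cont[of v u] e unfolding continuous_at_eps_delta by blast
  obtain d3 where d3: "d3 > 0" "ball x d3 \<subseteq> S" using S x openE by blast
  define d where "d = min d1 (min d2 d3)"
  have d: "d > 0" using d1 d2 d3 by (simp add: d_def)
  \<comment> \<open>This \<open>t\<close> keeps the whole parallelogram spanned by \<open>t u\<close>, \<open>t v\<close> within distance \<open>d\<close> of \<open>x\<close>.\<close>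
  define t where "t = d / (2 * (norm u + norm v + 1))"
  have pos: "norm u + norm v + 1 > 0" by (simp add: add_nonneg_pos)
  have t: "t > 0" using d pos by (simp add: t_def)
  have near: "dist (x + (a *\<^sub>R u + b *\<^sub>R v)) x < d" if "0 \<le> a" "a \<le> t" "0 \<le> b" "b \<le> t" for a b
  proof -
    have "norm (a *\<^sub>R u + b *\<^sub>R v) \<le> a * norm u + b * norm v"
      using norm_triangle_ineq[of "a *\<^sub>R u" "b *\<^sub>R v"] that by simp
    also have "\<dots> \<le> t * norm u + t * norm v" using that by (intro add_mono mult_right_mono) auto
    also have "\<dots> \<le> t * (norm u + norm v + 1)" using t by (simp add: algebra_simps)
    also have "\<dots> = d / 2" using pos by (simp add: t_def field_simps)
    finally show ?thesis using d by (simp add: dist_norm)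
  qed
  have inS: "x + a *\<^sub>R u + b *\<^sub>R v \<in> S" if "0 \<le> a" "a \<le> t" "0 \<le> b" "b \<le> t" for a b
    using near[OF that] d3(2) by (auto simp: d_def dist_commute add.assoc)
  obtain a b where ab: "0 < a" "a < t" "0 < b" "b < t"
    and 1: "f (x + t *\<^sub>R u + t *\<^sub>R v) - f (x + t *\<^sub>R u) - f (x + t *\<^sub>R v) + f x
     = t\<^sup>2 * p u v (x + a *\<^sub>R u + b *\<^sub>R v)"
    using second_difference_mean_value[OF f t inS] unfolding p_def by blast
  have inS': "x + a *\<^sub>R v + b *\<^sub>R u \<in> S" if "0 \<le> a" "a \<le> t" "0 \<le> b" "b \<le> t" for a b
    using inS[of b a] that by (simp add: algebra_simps)
  obtain a' b' where ab': "0 < a'" "a' < t" "0 < b'" "b' < t"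
    and 2: "f (x + t *\<^sub>R v + t *\<^sub>R u) - f (x + t *\<^sub>R v) - f (x + t *\<^sub>R u) + f x
     = t\<^sup>2 * p v u (x + a' *\<^sub>R v + b' *\<^sub>R u)"
    using second_difference_mean_value[OF f t inS'] unfolding p_def by blast
  have "t\<^sup>2 * p u v (x + a *\<^sub>R u + b *\<^sub>R v) = t\<^sup>2 * p v u (x + a' *\<^sub>R v + b' *\<^sub>R u)"
    using 1 2 by (simp add: algebra_simps)
  then have eq: "p u v (x + a *\<^sub>R u + b *\<^sub>R v) = p v u (x + a' *\<^sub>R v + b' *\<^sub>R u)" using t by simp
  have "dist (p u v (x + a *\<^sub>R u + b *\<^sub>R v)) (p u v x) < e"
    using near[of a b] ab by (intro d1(2)) (simp add: d_def add.assoc)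
  moreover have "dist (p v u (x + a' *\<^sub>R v + b' *\<^sub>R u)) (p v u x) < e"
    using near[of b' a'] ab' by (intro d2(2)) (simp add: d_def algebra_simps)
  ultimately show False using eq by (simp add: e_def dist_real_def abs_if split: if_splits)
qed

text \<open>\<open>frechet_derivative\<close> chooses from the set of all derivatives at the point, and this set depends on
  the germ of the function only. Hence the differential of an arbitrary function is local.\<close>
lemma frechet_derivative_cong_open:
  assumes "open S" "x \<in> S" "\<And>y. y \<in> S \<Longrightarrow> f y = g y"
  shows "frechet_derivative f (at x) = frechet_derivative g (at x)"
proof -
  have "(f has_derivative L) (at x) \<longleftrightarrow> (g has_derivative L) (at x)" for L
    using assms has_derivative_transform_within_open by (metis (no_types, opaque_lifting))
  then show ?thesis unfolding frechet_derivative_def by simp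
qed

lemma frechet_derivative_eqI: "(f has_derivative L) (at x) \<Longrightarrow> frechet_derivative f (at x) v = L v"
  using frechet_derivative_at by metis

text \<open>\<open>X (Y f)\<close> in coordinates: besides the derivative of \<open>f\<close> along the derivative of \<open>Y\<close> there is only the
  Hessian of \<open>f\<close>. Because the Hessian is symmetric, it cancels in the commutator \<open>X (Y f) - Y (X f)\<close>,
  which is therefore a first order expression in \<open>f\<close>.\<close>
lemma derivative_of_directional_derivative:
  fixes f :: "'a::euclidean_space \<Rightarrow> real"
  assumes f: "smooth_on f S" and Y: "smooth_on Y S" and S: "open S" and x: "x \<in> S"
  shows "frechet_derivative (\<lambda>z. frechet_derivative f (at z) (Y z)) (at x) w
       = frechet_derivative f (at x) (frechet_derivative Y (at x) w)
       + frechet_derivative (\<lambda>z. frechet_derivative f (at z) w) (at x) (Y x)"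
proof -
  let ?f' = "\<lambda>b z. frechet_derivative f (at z) b"
  have lin: "linear (frechet_derivative f (at z))" if "z \<in> S" for z
    by (rule linear_frechet_derivative[OF smooth_on_differentiable[OF f that]])
  have lin2: "linear (frechet_derivative (?f' w) (at x))"
    by (rule linear_frechet_derivative[OF smooth_on_differentiable[OF smooth_on_derivative[OF f] x]])
  have "frechet_derivative (\<lambda>z. ?f' (Y z) z) (at x) w
      = frechet_derivative (\<lambda>z. \<Sum>b\<in>Basis. (Y z \<bullet> b) * ?f' b z) (at x) w"
    using linear_eq_sum_Basis[OF lin] by (subst frechet_derivative_cong_open[OF S x]) auto
  also have "((\<lambda>z. \<Sum>b\<in>Basis. (Y z \<bullet> b) * ?f' b z) has_derivative
      (\<lambda>w. \<Sum>b\<in>Basis. (Y x \<bullet> b) * frechet_derivative (?f' b) (at x) w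
            + (frechet_derivative Y (at x) w \<bullet> b) * ?f' b x)) (at x)"
    by (intro has_derivative_sum has_derivative_mult has_derivative_inner_left
        smooth_on_has_derivative[OF Y x] smooth_on_has_derivative[OF smooth_on_derivative[OF f] x])
  note frechet_derivative_eqI[OF this]
  also have "(\<Sum>b\<in>Basis. (Y x \<bullet> b) * frechet_derivative (?f' b) (at x) w
            + (frechet_derivative Y (at x) w \<bullet> b) * ?f' b x)
       = (\<Sum>b\<in>Basis. (Y x \<bullet> b) *\<^sub>R frechet_derivative (?f' w) (at x) b)
       + (\<Sum>b\<in>Basis. (frechet_derivative Y (at x) w \<bullet> b) *\<^sub>R ?f' b x)"
    by (simp add: sum.distrib symmetric_second_derivative[OF f S x, of _ w])
  also have "\<dots> = frechet_derivative (?f' w) (at x) (Y x) + ?f' (frechet_derivative Y (at x) w) x"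
    using linear_eq_sum_Basis[OF lin[OF x], of "frechet_derivative Y (at x) w"]
      linear_eq_sum_Basis[OF lin2, of "Y x"] by simp
  finally show ?thesis by simp
qed

section \<open>Charts and components\<close>

definition vf_in_chart ::
  "('m, 'd::finite) chart set \<Rightarrow> ('m, 'd) chart \<Rightarrow> ('m \<Rightarrow> real ^ 'd) \<Rightarrow> real ^ 'd \<Rightarrow> real ^ 'd" where
  "vf_in_chart A c X x = components A c (chart_inv c x) (X (chart_inv c x))"

definition transition_deriv ::
  "('m, 'd::finite) chart \<Rightarrow> ('m, 'd) chart \<Rightarrow> 'm \<Rightarrow> real ^ 'd \<Rightarrow> real ^ 'd" where
  "transition_deriv c e p = frechet_derivative (snd e \<circ> chart_inv c) (at (snd c p))"

text \<open>The field with constant components \<open>w\<close> in the chart \<open>c\<close>. The derivative of the transition from \<open>c\<close>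
  to the preferred chart translates these components into the identification of the tangent space at
  \<open>p\<close> with \<open>real ^ 'd\<close>. For \<open>w\<close> in the standard basis these fields are a frame over the chart domain.\<close>
definition coord_field ::
  "('m, 'd::finite) chart set \<Rightarrow> ('m, 'd) chart \<Rightarrow> real ^ 'd \<Rightarrow> 'm \<Rightarrow> real ^ 'd" where
  "coord_field A c w p = transition_deriv c (chart_at A p) p w"

locale smooth_manifold =
  fixes A :: "('m::{t2_space, second_countable_topology}, 'd::finite) chart set"
  assumes atlas: "smooth_atlas A"
begin

lemma chart_homeomorphism:
  "c \<in> A \<Longrightarrow> homeomorphism (fst c) (snd c ` fst c) (snd c) (chart_inv c)"
  using atlas by (simp add: smooth_atlas_def)

lemma open_chart_domain: "c \<in> A \<Longrightarrow> open (fst c)"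
  using atlas by (simp add: smooth_atlas_def)

lemma chart_inv_left: "c \<in> A \<Longrightarrow> p \<in> fst c \<Longrightarrow> chart_inv c (snd c p) = p"
  using chart_homeomorphism by (auto simp: homeomorphism_def)

lemma open_chart_image:
  assumes c: "c \<in> A" and U: "open U"
  shows "open (snd c ` (fst c \<inter> U))"
proof -
  have "snd c ` (fst c \<inter> U) = (snd c ` fst c) \<inter> chart_inv c -` U"
    using chart_inv_left[OF c] by auto
  moreover have "continuous_on (snd c ` fst c) (chart_inv c)" "open (snd c ` fst c)"
    using chart_homeomorphism[OF c] atlas c by (auto simp: homeomorphism_def smooth_atlas_def)
  ultimately show ?thesis using U continuous_open_preimage by metis
qed

lemma chart_at_in_atlas: "chart_at A p \<in> A" and in_chart_at: "p \<in> fst (chart_at A p)"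
proof -
  have "\<exists>c. c \<in> A \<and> p \<in> fst c" using atlas unfolding smooth_atlas_def by blast
  then show "chart_at A p \<in> A" "p \<in> fst (chart_at A p)"
    unfolding chart_at_def by (metis (mono_tags, lifting) someI_ex)+
qed

lemma smooth_transition:
  "c \<in> A \<Longrightarrow> e \<in> A \<Longrightarrow> smooth_on (snd e \<circ> chart_inv c) (snd c ` (fst c \<inter> fst e))"
  using atlas by (simp add: smooth_atlas_def)

lemma transition_has_derivative:
  assumes "c \<in> A" "e \<in> A" "p \<in> fst c" "p \<in> fst e"
  shows "((snd e \<circ> chart_inv c) has_derivative transition_deriv c e p) (at (snd c p))"
  unfolding transition_deriv_def
  using smooth_on_has_derivative[OF smooth_transition[OF assms(1,2)]] assms by blast

lemma linear_transition_deriv: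
  "c \<in> A \<Longrightarrow> e \<in> A \<Longrightarrow> p \<in> fst c \<Longrightarrow> p \<in> fst e \<Longrightarrow> linear (transition_deriv c e p)"
  using transition_has_derivative has_derivative_linear by blast

text \<open>All rules for changing charts, for functions as well as for the transition maps themselves, are
  instances of this chain rule.\<close>
lemma has_derivative_change_chart:
  fixes F :: "'m \<Rightarrow> 'b::real_normed_vector"
  assumes ce: "c \<in> A" "e \<in> A" "p \<in> fst c" "p \<in> fst e"
    and F: "((F \<circ> chart_inv e) has_derivative L) (at (snd e p))"
  shows "((F \<circ> chart_inv c) has_derivative (\<lambda>v. L (transition_deriv c e p v))) (at (snd c p))"
proof (rule has_derivative_transform_within_open)
  have "(F \<circ> chart_inv e has_derivative L) (at ((snd e \<circ> chart_inv c) (snd c p)))"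
    using F ce by (simp add: chart_inv_left)
  from has_derivative_compose[OF transition_has_derivative[OF ce] this]
  show "((\<lambda>x. (F \<circ> chart_inv e) ((snd e \<circ> chart_inv c) x)) has_derivative
         (\<lambda>v. L (transition_deriv c e p v))) (at (snd c p))" .
  show "open (snd c ` (fst c \<inter> fst e))" using ce by (intro open_chart_image open_chart_domain)
  show "snd c p \<in> snd c ` (fst c \<inter> fst e)" using ce by blast
  show "(F \<circ> chart_inv e) ((snd e \<circ> chart_inv c) x) = (F \<circ> chart_inv c) x"
    if "x \<in> snd c ` (fst c \<inter> fst e)" for x
    using that ce by (auto simp: chart_inv_left)
qed

lemma transition_deriv_chain:
  assumes "c \<in> A" "e \<in> A" "d \<in> A" "p \<in> fst c" "p \<in> fst e" "p \<in> fst d"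
  shows "transition_deriv e d p (transition_deriv c e p v) = transition_deriv c d p v"
  using frechet_derivative_eqI[OF has_derivative_change_chart
      [OF assms(1,2,4,5) transition_has_derivative[OF assms(2,3,5,6)]], of v]
  by (simp add: transition_deriv_def)

lemma transition_deriv_refl:
  assumes "c \<in> A" "p \<in> fst c"
  shows "transition_deriv c c p v = v"
proof -
  have "frechet_derivative (snd c \<circ> chart_inv c) (at (snd c p)) = frechet_derivative (\<lambda>x. x) (at (snd c p))"
    by (rule frechet_derivative_cong_open[OF open_chart_image[OF assms(1) open_UNIV]])
      (use assms in \<open>auto simp: chart_inv_left\<close>)
  then show ?thesis by (simp add: transition_deriv_def)
qed

lemma components_eq: "components A c p = transition_deriv (chart_at A p) c p"
  by (simp add: components_def transition_deriv_def fun_eq_iff)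

lemma linear_components: "c \<in> A \<Longrightarrow> p \<in> fst c \<Longrightarrow> linear (components A c p)"
  by (simp add: components_eq linear_transition_deriv chart_at_in_atlas in_chart_at)

lemma components_change_chart:
  "c \<in> A \<Longrightarrow> e \<in> A \<Longrightarrow> p \<in> fst c \<Longrightarrow> p \<in> fst e \<Longrightarrow>
   transition_deriv c e p (components A c p v) = components A e p v"
  by (simp add: components_eq transition_deriv_chain chart_at_in_atlas in_chart_at)

lemma components_coord_field:
  "c \<in> A \<Longrightarrow> p \<in> fst c \<Longrightarrow> components A c p (coord_field A c w p) = w"
  by (simp add: components_eq coord_field_def transition_deriv_chain transition_deriv_refl
      chart_at_in_atlas in_chart_at)

lemma coord_field_components:
  "c \<in> A \<Longrightarrow> p \<in> fst c \<Longrightarrow> coord_field A c (components A c p v) p = v"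
  by (simp add: components_eq coord_field_def transition_deriv_chain transition_deriv_refl
      chart_at_in_atlas in_chart_at)

lemma linear_coord_field: "c \<in> A \<Longrightarrow> p \<in> fst c \<Longrightarrow> linear (\<lambda>w. coord_field A c w p)"
  by (simp add: coord_field_def linear_transition_deriv chart_at_in_atlas in_chart_at)

lemma components_inject:
  "c \<in> A \<Longrightarrow> p \<in> fst c \<Longrightarrow> components A c p v = components A c p w \<Longrightarrow> v = w"
  by (metis coord_field_components)

section \<open>Smooth functions and vector fields\<close>

lemma smooth_fun_on_subset: "smooth_fun_on A U f \<Longrightarrow> V \<subseteq> U \<Longrightarrow> smooth_fun_on A V f"
  unfolding smooth_fun_on_def by (meson smooth_on_subset image_mono Int_mono order_refl)

lemma vec_fields_subset: "X \<in> vec_fields A U \<Longrightarrow> open V \<Longrightarrow> V \<subseteq> U \<Longrightarrow> X \<in> vec_fields A V"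
  unfolding vec_fields_def smooth_vf_on_def mem_Collect_eq
  by (meson smooth_on_subset image_mono Int_mono order_refl)

lemma vec_fields_open: "X \<in> vec_fields A U \<Longrightarrow> open U"
  by (simp add: vec_fields_def)

lemma vec_fields_iff:
  "X \<in> vec_fields A U \<longleftrightarrow> open U \<and> (\<forall>c\<in>A. smooth_on (vf_in_chart A c X) (snd c ` (fst c \<inter> U)))"
  by (simp add: vec_fields_def smooth_vf_on_def vf_in_chart_def[abs_def])

lemma vf_in_chart_at: "c \<in> A \<Longrightarrow> p \<in> fst c \<Longrightarrow> vf_in_chart A c X (snd c p) = components A c p (X p)"
  by (simp add: vf_in_chart_def chart_inv_left)

text \<open>Smoothness in the sense of all charts of the atlas follows from smoothness in a single chart that
  covers the open set; this is how local fields such as the coordinate fields are produced.\<close>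
lemma smooth_fun_on_chartI:
  assumes c: "c \<in> A" and U: "open U" "U \<subseteq> fst c" and f: "smooth_on (f \<circ> chart_inv c) (snd c ` U)"
  shows "smooth_fun_on A U f"
  unfolding smooth_fun_on_def
proof
  fix e assume e: "e \<in> A"
  have o: "open (snd e ` (fst e \<inter> U))" "open (snd c ` U)"
    using open_chart_image[OF e U(1)] open_chart_image[OF c U(1)] U(2) by (auto simp: Int_absorb1)
  have "smooth_on (snd c \<circ> chart_inv e) (snd e ` (fst e \<inter> U))"
    using smooth_transition[OF e c] by (rule smooth_on_subset) (use U in auto)
  moreover have "(snd c \<circ> chart_inv e) ` (snd e ` (fst e \<inter> U)) \<subseteq> snd c ` U"
    using e by (auto simp: chart_inv_left)
  ultimately have "smooth_on (\<lambda>x. (f \<circ> chart_inv c) ((snd c \<circ> chart_inv e) x)) (snd e ` (fst e \<inter> U))"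
    using smooth_on_compose[OF _ f _ o] by blast
  then show "smooth_on (f \<circ> chart_inv e) (snd e ` (fst e \<inter> U))"
    by (subst smooth_on_cong[OF o(1), where g = "\<lambda>x. (f \<circ> chart_inv c) ((snd c \<circ> chart_inv e) x)"])
      (use U e c in \<open>auto simp: chart_inv_left subset_iff\<close>)
qed

lemma vec_fields_chartI:
  assumes c: "c \<in> A" and U: "open U" "U \<subseteq> fst c" and X: "smooth_on (vf_in_chart A c X) (snd c ` U)"
  shows "X \<in> vec_fields A U"
  unfolding vec_fields_iff
proof (intro conjI ballI)
  show "open U" by fact
  fix e assume e: "e \<in> A"
  have o: "open (snd e ` (fst e \<inter> U))" using open_chart_image[OF e U(1)] .
  have o': "open (snd c ` (fst e \<inter> U))"
    using open_chart_image[OF c open_Int[OF open_chart_domain[OF e] U(1)]] U(2)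
    by (simp add: Int_absorb1 inf.coboundedI2)
  have tr: "smooth_on (snd c \<circ> chart_inv e) (snd e ` (fst e \<inter> U))"
    using smooth_transition[OF e c] by (rule smooth_on_subset) (use U in auto)
  have "smooth_on (\<lambda>y. frechet_derivative (snd e \<circ> chart_inv c) (at y) (vf_in_chart A c X y)) (snd c ` (fst e \<inter> U))"
    by (rule smooth_on_directional_derivative[OF _ _ o'])
      (use smooth_transition[OF c e] X U in \<open>auto elim!: smooth_on_subset\<close>)
  moreover have "(snd c \<circ> chart_inv e) ` (snd e ` (fst e \<inter> U)) \<subseteq> snd c ` (fst e \<inter> U)"
    using e by (auto simp: chart_inv_left)
  ultimately have "smooth_on (\<lambda>x. frechet_derivative (snd e \<circ> chart_inv c) (at ((snd c \<circ> chart_inv e) x))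
          (vf_in_chart A c X ((snd c \<circ> chart_inv e) x))) (snd e ` (fst e \<inter> U))"
    using smooth_on_compose[OF tr _ _ o o'] by blast
  moreover have "vf_in_chart A e X x = frechet_derivative (snd e \<circ> chart_inv c) (at ((snd c \<circ> chart_inv e) x))
          (vf_in_chart A c X ((snd c \<circ> chart_inv e) x))" if x: "x \<in> snd e ` (fst e \<inter> U)" for x
  proof -
    obtain q where q: "q \<in> fst e" "q \<in> U" "x = snd e q" using x by auto
    then have "q \<in> fst c" using U by auto
    then show ?thesis using q c e components_change_chart[OF c e, of q]
      by (simp add: vf_in_chart_at chart_inv_left transition_deriv_def)
  qed
  ultimately show "smooth_on (vf_in_chart A e X) (snd e ` (fst e \<inter> U))"
    using smooth_on_cong[OF o] by (metis (no_types, lifting))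
qed

lemma smooth_fun_on_chartwise:
  "(\<And>c. c \<in> A \<Longrightarrow> smooth_fun_on A (fst c \<inter> U) f) \<Longrightarrow> smooth_fun_on A U f"
  unfolding smooth_fun_on_def by (metis Int_absorb Int_assoc)

lemma smooth_fun_onI: "(\<And>c. c \<in> A \<Longrightarrow> smooth_on (\<lambda>x. f (chart_inv c x)) (snd c ` (fst c \<inter> U))) \<Longrightarrow> smooth_fun_on A U f"
  by (simp add: smooth_fun_on_def o_def)

lemma smooth_fun_onD: "smooth_fun_on A U f \<Longrightarrow> c \<in> A \<Longrightarrow> smooth_on (\<lambda>x. f (chart_inv c x)) (snd c ` (fst c \<inter> U))"
  by (simp add: smooth_fun_on_def o_def)

lemma smooth_fun_on_const: "smooth_fun_on A U (\<lambda>_. a)"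
  by (rule smooth_fun_onI) (rule smooth_on_const)

lemma smooth_fun_on_add:
  assumes "smooth_fun_on A U f" "smooth_fun_on A U g" "open U"
  shows "smooth_fun_on A U (\<lambda>q. f q + g q)"
  by (rule smooth_fun_onI, rule smooth_on_add)
    (use assms in \<open>auto intro: smooth_fun_onD open_chart_image\<close>)

lemma smooth_fun_on_mult:
  assumes "smooth_fun_on A U f" "smooth_fun_on A U g" "open U"
  shows "smooth_fun_on A U (\<lambda>q. f q * g q)"
  by (rule smooth_fun_onI, rule smooth_on_bounded_bilinear[OF bounded_bilinear_mult])
    (use assms in \<open>auto intro: smooth_fun_onD open_chart_image\<close>)

lemma smooth_fun_on_diff:
  "smooth_fun_on A U f \<Longrightarrow> smooth_fun_on A U g \<Longrightarrow> open U \<Longrightarrow> smooth_fun_on A U (\<lambda>q. f q - g q)"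
  using smooth_fun_on_add[of U f "\<lambda>q. (-1) * g q"] smooth_fun_on_mult[OF smooth_fun_on_const, of U g "-1"]
  by simp

lemma smooth_fun_on_sum:
  assumes "\<And>i. i \<in> I \<Longrightarrow> smooth_fun_on A U (f i)" "open U"
  shows "smooth_fun_on A U (\<lambda>q. \<Sum>i\<in>I. f i q)"
  by (rule smooth_fun_onI, rule smooth_on_sum)
    (use assms in \<open>auto intro: smooth_fun_onD open_chart_image\<close>)

lemma smooth_fun_on_cong:
  assumes "open U" "\<And>q. q \<in> U \<Longrightarrow> f q = g q" "smooth_fun_on A U f"
  shows "smooth_fun_on A U g"
proof (rule smooth_fun_onI)
  fix c assume c: "c \<in> A"
  show "smooth_on (\<lambda>x. g (chart_inv c x)) (snd c ` (fst c \<inter> U))"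
    using smooth_fun_onD[OF assms(3) c]
    by (rule smooth_on_cong[THEN iffD1, rotated -1])
      (use assms c open_chart_image in \<open>auto simp: chart_inv_left\<close>)
qed

lemma vec_fields_add:
  assumes "X \<in> vec_fields A U" "Y \<in> vec_fields A U"
  shows "(\<lambda>q. X q + Y q) \<in> vec_fields A U"
  unfolding vec_fields_iff
proof (intro conjI ballI)
  show U: "open U" using assms vec_fields_open by blast
  fix c assume c: "c \<in> A"
  have "smooth_on (\<lambda>x. vf_in_chart A c X x + vf_in_chart A c Y x) (snd c ` (fst c \<inter> U))"
    using assms c open_chart_image[OF c U] by (intro smooth_on_add) (auto simp: vec_fields_iff)
  then show "smooth_on (vf_in_chart A c (\<lambda>q. X q + Y q)) (snd c ` (fst c \<inter> U))"
    by (rule smooth_on_cong[OF open_chart_image[OF c U], THEN iffD1, rotated])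
      (auto simp: c vf_in_chart_at linear_add[OF linear_components[OF c]])
qed

lemma vec_fields_scale:
  assumes "smooth_fun_on A U f" "X \<in> vec_fields A U"
  shows "(\<lambda>q. f q *\<^sub>R X q) \<in> vec_fields A U"
  unfolding vec_fields_iff
proof (intro conjI ballI)
  show U: "open U" using assms vec_fields_open by blast
  fix c assume c: "c \<in> A"
  have "smooth_on (\<lambda>x. f (chart_inv c x) *\<^sub>R vf_in_chart A c X x) (snd c ` (fst c \<inter> U))"
    using assms c open_chart_image[OF c U] smooth_fun_onD[OF assms(1) c]
    by (intro smooth_on_bounded_bilinear[OF bounded_bilinear_scaleR]) (auto simp: vec_fields_iff)
  then show "smooth_on (vf_in_chart A c (\<lambda>q. f q *\<^sub>R X q)) (snd c ` (fst c \<inter> U))"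
    by (rule smooth_on_cong[OF open_chart_image[OF c U], THEN iffD1, rotated])
      (auto simp: c vf_in_chart_at chart_inv_left linear_scale[OF linear_components[OF c]])
qed

lemma vec_fields_minus: "X \<in> vec_fields A U \<Longrightarrow> (\<lambda>q. - X q) \<in> vec_fields A U"
  using vec_fields_scale[OF smooth_fun_on_const, of X U "-1"] by simp

lemma vec_fields_diff:
  "X \<in> vec_fields A U \<Longrightarrow> Y \<in> vec_fields A U \<Longrightarrow> (\<lambda>q. X q - Y q) \<in> vec_fields A U"
  using vec_fields_add[OF _ vec_fields_minus, of X U Y] by simp

lemma coord_field_vec_field:
  assumes c: "c \<in> A"
  shows "coord_field A c w \<in> vec_fields A (fst c)"
proof (rule vec_fields_chartI[OF c open_chart_domain[OF c] order_refl])
  have o: "open (snd c ` fst c)" using open_chart_image[OF c open_UNIV] by simp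
  show "smooth_on (vf_in_chart A c (coord_field A c w)) (snd c ` fst c)"
    by (rule smooth_on_cong[OF o, THEN iffD2, OF _ smooth_on_const[of w]])
     (use c in \<open>auto simp: vf_in_chart_at components_coord_field\<close>)
qed

lemma vec_fields_zero:
  assumes U: "open U"
  shows "(\<lambda>q. 0) \<in> vec_fields A U"
  unfolding vec_fields_iff
proof (intro conjI ballI)
  fix c assume c: "c \<in> A"
  show "smooth_on (vf_in_chart A c (\<lambda>q. 0)) (snd c ` (fst c \<inter> U))"
    by (rule smooth_on_cong[OF open_chart_image[OF c U], THEN iffD1, OF _ smooth_on_const[of 0]])
      (auto simp: c vf_in_chart_at linear_0[OF linear_components[OF c]])
qed (rule U)

lemma vec_fields_sum:
  assumes "\<And>i. i \<in> I \<Longrightarrow> X i \<in> vec_fields A U" "open U"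
  shows "(\<lambda>q. \<Sum>i\<in>I. X i q) \<in> vec_fields A U"
  using assms by (induction I rule: infinite_finite_induct) (auto intro: vec_fields_add vec_fields_zero)

lemma vec_field_component_smooth:
  assumes X: "X \<in> vec_fields A U" and c: "c \<in> A"
  shows "smooth_fun_on A (fst c \<inter> U) (\<lambda>q. components A c q (X q) \<bullet> b)"
proof (rule smooth_fun_on_chartI[OF c])
  have U: "open U" using X vec_fields_open by blast
  show "open (fst c \<inter> U)" using U open_chart_domain[OF c] by blast
  show "smooth_on ((\<lambda>q. components A c q (X q) \<bullet> b) \<circ> chart_inv c) (snd c ` (fst c \<inter> U))"
    using smooth_on_bounded_linear[OF bounded_linear_inner_left, of "vf_in_chart A c X" _ b]
      X c open_chart_image[OF c U] by (simp add: vec_fields_iff vf_in_chart_def o_def)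
qed auto

lemma vec_field_expansion:
  assumes "c \<in> A" "q \<in> fst c"
  shows "v = (\<Sum>b\<in>Basis. (components A c q v \<bullet> b) *\<^sub>R coord_field A c b q)"
  using linear_eq_sum_Basis[OF linear_coord_field[OF assms], of "components A c q v"]
  by (simp add: coord_field_components[OF assms])

text \<open>Coordinate fields provide local extensions of every tangent vector. Tensors given by a definite
  description over extensions are evaluated by means of such extensions.\<close>
lemma vec_field_through:
  "\<exists>X \<in> vec_fields A (fst (chart_at A p)). X p = v"
  using coord_field_vec_field coord_field_components chart_at_in_atlas in_chart_at by metis

lemma differential_cong:
  assumes "open V" "p \<in> V" "\<And>q. q \<in> V \<Longrightarrow> f q = g q"
  shows "differential A f p = differential A g p"
proof -
  have "frechet_derivative (f \<circ> chart_inv (chart_at A p)) (at (snd (chart_at A p) p))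
      = frechet_derivative (g \<circ> chart_inv (chart_at A p)) (at (snd (chart_at A p) p))"
    by (rule frechet_derivative_cong_open[OF open_chart_image[OF chart_at_in_atlas assms(1)]])
      (use assms in_chart_at chart_at_in_atlas in \<open>auto simp: chart_inv_left\<close>)
  then show ?thesis by (simp add: differential_def fun_eq_iff)
qed

lemma smooth_fun_chart_derivative:
  assumes "smooth_fun_on A U f" "p \<in> U" "c \<in> A" "p \<in> fst c"
  shows "((\<lambda>x. f (chart_inv c x)) has_derivative
      frechet_derivative (\<lambda>x. f (chart_inv c x)) (at (snd c p))) (at (snd c p))"
  using smooth_on_has_derivative[OF smooth_fun_onD[OF assms(1,3)]] assms by blast

lemma differential_in_chart:
  assumes f: "smooth_fun_on A U f" and p: "p \<in> U" "p \<in> fst c" and c: "c \<in> A"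
  shows "differential A f p v = frechet_derivative (\<lambda>x. f (chart_inv c x)) (at (snd c p)) (components A c p v)"
  using has_derivative_change_chart[OF chart_at_in_atlas c in_chart_at p(2),
      of f, unfolded o_def, OF smooth_fun_chart_derivative[OF f p(1) c p(2)]]
  by (simp add: differential_def o_def components_eq frechet_derivative_eqI)

lemma differential_has_derivative:
  assumes f: "smooth_fun_on A U f" and p: "p \<in> U"
  shows "((\<lambda>x. f (chart_inv (chart_at A p) x)) has_derivative differential A f p) (at (snd (chart_at A p) p))"
  using smooth_fun_chart_derivative[OF f p chart_at_in_atlas in_chart_at]
  by (simp add: differential_def[abs_def] o_def)

lemma differential_const: "differential A (\<lambda>_. a) p v = 0"
  by (simp add: differential_def o_def)

lemma differential_diff:
  assumes "smooth_fun_on A U f" "smooth_fun_on A U g" "p \<in> U"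
  shows "differential A (\<lambda>q. f q - g q) p v = differential A f p v - differential A g p v"
  using has_derivative_diff[OF differential_has_derivative[OF assms(1,3)] differential_has_derivative[OF assms(2,3)]]
  by (subst differential_def) (simp add: o_def frechet_derivative_eqI)

lemma differential_mult:
  assumes "smooth_fun_on A U f" "smooth_fun_on A U g" "p \<in> U"
  shows "differential A (\<lambda>q. f q * g q) p v = f p * differential A g p v + differential A f p v * g p"
  using has_derivative_mult[OF differential_has_derivative[OF assms(1,3)] differential_has_derivative[OF assms(2,3)]]
  by (subst differential_def) (simp add: o_def frechet_derivative_eqI chart_inv_left chart_at_in_atlas in_chart_at)

lemma differential_cmult:
  assumes "smooth_fun_on A U f" "p \<in> U"
  shows "differential A (\<lambda>q. a * f q) p v = a * differential A f p v"
  using differential_mult[OF smooth_fun_on_const assms] by (simp add: differential_const)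

lemma smooth_differential:
  assumes f: "smooth_fun_on A U f" and X: "X \<in> vec_fields A U"
  shows "smooth_fun_on A U (\<lambda>q. differential A f q (X q))"
proof (rule smooth_fun_onI)
  have U: "open U" using X vec_fields_open by blast
  fix c assume c: "c \<in> A"
  have "smooth_on (\<lambda>x. frechet_derivative (\<lambda>x. f (chart_inv c x)) (at x) (vf_in_chart A c X x)) (snd c ` (fst c \<inter> U))"
    using smooth_fun_onD[OF f c] X c open_chart_image[OF c U]
    by (intro smooth_on_directional_derivative) (auto simp: vec_fields_iff)
  then show "smooth_on (\<lambda>x. differential A f (chart_inv c x) (X (chart_inv c x))) (snd c ` (fst c \<inter> U))"
    by (rule smooth_on_cong[OF open_chart_image[OF c U], THEN iffD1, rotated])
      (use c in \<open>auto simp: differential_in_chart[OF f] vf_in_chart_at chart_inv_left\<close>)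
qed

section \<open>The Lie bracket\<close>

text \<open>The coordinate functions already determine a tangent vector. This gives the uniqueness part of
  the definite description that defines the bracket.\<close>
lemma differentials_separate:
  assumes eq: "\<And>U f. open U \<Longrightarrow> p \<in> U \<Longrightarrow> smooth_fun_on A U f \<Longrightarrow> differential A f p v = differential A f p w"
  shows "v = w"
proof -
  define c where "c = chart_at A p"
  have c: "c \<in> A" "p \<in> fst c" by (simp_all add: c_def chart_at_in_atlas in_chart_at)
  have o: "open (snd c ` fst c)" using open_chart_image[OF c(1) open_UNIV] by simp
  have "components A c p v \<bullet> b = components A c p w \<bullet> b" for b
  proof -
    have "smooth_on (\<lambda>x. x) (snd c ` fst c)"
      unfolding smooth_on_def
    proof
      show "Ck_on k (\<lambda>x. x) (snd c ` fst c)" for k by (cases k) (auto simp: Ck_on_const)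
    qed
    then have "smooth_on (\<lambda>x. x \<bullet> b) (snd c ` fst c)"
      by (rule smooth_on_bounded_linear[OF bounded_linear_inner_left _ o])
    then have "smooth_on ((\<lambda>q. snd c q \<bullet> b) \<circ> chart_inv c) (snd c ` fst c)"
      by (rule smooth_on_cong[OF o, THEN iffD1, rotated]) (use c in \<open>auto simp: chart_inv_left\<close>)
    then have f: "smooth_fun_on A (fst c) (\<lambda>q. snd c q \<bullet> b)"
      by (intro smooth_fun_on_chartI[OF c(1) open_chart_domain[OF c(1)] order_refl])
    have "frechet_derivative (\<lambda>x. snd c (chart_inv c x) \<bullet> b) (at (snd c p))
        = frechet_derivative (\<lambda>x. x \<bullet> b) (at (snd c p))"
      by (rule frechet_derivative_cong_open[OF o]) (use c in \<open>auto simp: chart_inv_left\<close>)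
    also have "\<dots> = (\<lambda>h. h \<bullet> b)"
      by (rule frechet_derivative_at[symmetric]) (auto intro!: derivative_eq_intros)
    finally show ?thesis
      using eq[OF open_chart_domain[OF c(1)] c(2) f] differential_in_chart[OF f c(2,2,1)] by metis
  qed
  then have "components A c p v = components A c p w" by (metis vector_eq_rdot)
  then show ?thesis using components_inject[OF c] by blast
qed

text \<open>The coordinate formula supplies a vector that acts as the commutator on all local functions, and
  by separation there is only one. Hence the bracket is both this vector and the commutator.\<close>
lemma lie_bracket_in_chart:
  assumes X: "X \<in> vec_fields A U" and Y: "Y \<in> vec_fields A U" and p: "p \<in> U" "p \<in> fst c" and c: "c \<in> A"
  defines "v \<equiv> coord_field A c
     (frechet_derivative (vf_in_chart A c Y) (at (snd c p)) (components A c p (X p))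
    - frechet_derivative (vf_in_chart A c X) (at (snd c p)) (components A c p (Y p))) p"
  shows "\<And>V f. open V \<Longrightarrow> p \<in> V \<Longrightarrow> smooth_fun_on A V f \<Longrightarrow>
        differential A f p (lie_bracket A X Y p) =
          differential A (\<lambda>q. differential A f q (Y q)) p (X p)
        - differential A (\<lambda>q. differential A f q (X q)) p (Y p)" (is "\<And>V f. _ \<Longrightarrow> _ \<Longrightarrow> _ \<Longrightarrow> _ = ?comm f")
    and "lie_bracket A X Y p = v"
proof -
  have U: "open U" using X vec_fields_open by blast
  have v: "differential A f p v = ?comm f" if V: "open V" "p \<in> V" and f: "smooth_fun_on A V f" for V f
  proof -
    let ?S = "snd c ` (fst c \<inter> (U \<inter> V))" and ?F = "\<lambda>x. f (chart_inv c x)"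
    have fUV: "smooth_fun_on A (U \<inter> V) f" using f by (rule smooth_fun_on_subset) auto
    have S: "open ?S" using open_chart_image[OF c] U V by blast
    have xS: "snd c p \<in> ?S" using p V by blast
    have F: "smooth_on ?F ?S" using smooth_fun_onD[OF fUV c] .
    have one: "differential A (\<lambda>q. differential A f q (Y q)) p (X p)
       = frechet_derivative ?F (at (snd c p)) (frechet_derivative (vf_in_chart A c Y) (at (snd c p)) (components A c p (X p)))
       + frechet_derivative (\<lambda>z. frechet_derivative ?F (at z) (components A c p (X p))) (at (snd c p)) (components A c p (Y p))"
      if X: "X \<in> vec_fields A U" and Y: "Y \<in> vec_fields A U" for X Y
    proof -
      have Y': "Y \<in> vec_fields A (U \<inter> V)" using vec_fields_subset[OF Y] U V by blast
      have sm: "smooth_fun_on A (U \<inter> V) (\<lambda>q. differential A f q (Y q))" by (rule smooth_differential[OF fUV Y'])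
      have "differential A (\<lambda>q. differential A f q (Y q)) p (X p) =
         frechet_derivative (\<lambda>x. differential A f (chart_inv c x) (Y (chart_inv c x))) (at (snd c p)) (components A c p (X p))"
        using differential_in_chart[OF sm _ p(2) c] p V by blast
      also have "frechet_derivative (\<lambda>x. differential A f (chart_inv c x) (Y (chart_inv c x))) (at (snd c p))
         = frechet_derivative (\<lambda>x. frechet_derivative ?F (at x) (vf_in_chart A c Y x)) (at (snd c p))"
        by (rule frechet_derivative_cong_open[OF S xS])
          (use c in \<open>auto simp: differential_in_chart[OF fUV] vf_in_chart_at chart_inv_left\<close>)
      also have "\<dots> (components A c p (X p)) = frechet_derivative ?F (at (snd c p)) (frechet_derivative (vf_in_chart A c Y) (at (snd c p)) (components A c p (X p)))
       + frechet_derivative (\<lambda>z. frechet_derivative ?F (at z) (components A c p (X p))) (at (snd c p)) (vf_in_chart A c Y (snd c p))"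
        by (rule derivative_of_directional_derivative[OF F _ S xS]) (use Y' c in \<open>auto simp: vec_fields_iff\<close>)
      finally show ?thesis using c p by (simp add: vf_in_chart_at)
    qed
    have "linear (frechet_derivative ?F (at (snd c p)))"
      by (rule linear_frechet_derivative[OF smooth_on_differentiable[OF F xS]])
    then show ?thesis
      unfolding one[OF X Y] one[OF Y X] v_def
      using differential_in_chart[OF f V(2) p(2) c] components_coord_field[OF c p(2)]
        symmetric_second_derivative[OF F S xS, of "components A c p (X p)" "components A c p (Y p)"]
      by (simp add: linear_diff)
  qed
  have "lie_bracket A X Y p = v"
    unfolding lie_bracket_def
  proof (rule the_equality)
    show "\<forall>U f. open U \<longrightarrow> p \<in> U \<longrightarrow> smooth_fun_on A U f \<longrightarrow> differential A f p v = ?comm f"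
      using v by blast
    fix w assume w: "\<forall>U f. open U \<longrightarrow> p \<in> U \<longrightarrow> smooth_fun_on A U f \<longrightarrow> differential A f p w = ?comm f"
    show "w = v"
    proof (rule differentials_separate)
      fix V f assume Vf: "open V" "p \<in> V" "smooth_fun_on A V f"
      show "differential A f p w = differential A f p v"
        using w[rule_format, OF Vf] v[OF Vf] by (rule trans[OF _ sym])
    qed
  qed
  then show "lie_bracket A X Y p = v" "\<And>V f. open V \<Longrightarrow> p \<in> V \<Longrightarrow> smooth_fun_on A V f \<Longrightarrow>
        differential A f p (lie_bracket A X Y p) = ?comm f" using v by auto
qed

lemma lie_bracket_commutator:
  assumes "X \<in> vec_fields A U" "Y \<in> vec_fields A U" "p \<in> U"
    and "open V" "p \<in> V" "smooth_fun_on A V f"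
  shows "differential A f p (lie_bracket A X Y p) =
          differential A (\<lambda>q. differential A f q (Y q)) p (X p)
        - differential A (\<lambda>q. differential A f q (X q)) p (Y p)"
  using lie_bracket_in_chart(1)[OF assms(1-3) in_chart_at chart_at_in_atlas assms(4-6)] .

lemma lie_bracket_coord_fields:
  assumes c: "c \<in> A" "p \<in> fst c"
  shows "lie_bracket A (coord_field A c u) (coord_field A c w) p = 0"
proof -
  have o: "open (snd c ` fst c)" using open_chart_image[OF c(1) open_UNIV] by simp
  have "frechet_derivative (vf_in_chart A c (coord_field A c w)) (at (snd c p)) = frechet_derivative (\<lambda>x. w) (at (snd c p))" for w
    by (rule frechet_derivative_cong_open[OF o])
      (use c in \<open>auto simp: vf_in_chart_at components_coord_field\<close>)
  then show ?thesis
    using lie_bracket_in_chart(2)[OF coord_field_vec_field[OF c(1)] coord_field_vec_field[OF c(1)] c(2,2,1)]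
      linear_0[OF linear_coord_field[OF c]] by simp
qed

section \<open>Locality and tensoriality\<close>

text \<open>An operator on global maps need not respect restriction to open sets a priori. If two fields agree
  on \<open>V\<close>, their difference \<open>W\<close> satisfies \<open>f W = W\<close> everywhere for the function \<open>f\<close> that is \<open>0\<close> on \<open>V\<close> and \<open>1\<close>
  elsewhere. This \<open>f\<close> is smooth on \<open>V\<close>, although not continuous on the manifold, so a product rule on \<open>V\<close>
  makes the operator vanish on \<open>W\<close>.\<close>
lemma local_operator_eq:
  fixes T :: "('m \<Rightarrow> real ^ 'd) \<Rightarrow> 'v::real_vector"
  assumes add: "\<And>U X Y. p \<in> U \<Longrightarrow> X \<in> vec_fields A U \<Longrightarrow> Y \<in> vec_fields A U \<Longrightarrow> T (\<lambda>q. X q + Y q) = T X + T Y"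
    and vanish: "\<And>U f X. p \<in> U \<Longrightarrow> X \<in> vec_fields A U \<Longrightarrow> smooth_fun_on A U f \<Longrightarrow> (\<And>q. q \<in> U \<Longrightarrow> f q = 0)
       \<Longrightarrow> T (\<lambda>q. f q *\<^sub>R X q) = 0"
    and V: "p \<in> V" "X \<in> vec_fields A V" "Y \<in> vec_fields A V" "\<And>q. q \<in> V \<Longrightarrow> X q = Y q"
  shows "T X = T Y"
proof -
  define f where "f = (\<lambda>q. if q \<in> V then 0 else 1 :: real)"
  define W where "W = (\<lambda>q. X q - Y q)"
  have W: "W \<in> vec_fields A V" unfolding W_def using V vec_fields_diff by blast
  have f: "smooth_fun_on A V f"
    by (rule smooth_fun_on_cong[OF vec_fields_open[OF V(2)] _ smooth_fun_on_const[of V 0]]) (simp add: f_def)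
  have "(\<lambda>q. f q *\<^sub>R W q) = W" using V(4) by (auto simp: f_def W_def)
  then have "T W = 0" using vanish[OF V(1) W f] by (simp add: f_def)
  then have "T (\<lambda>q. Y q + W q) = T Y" using add[OF V(1,3) W] by simp
  then show ?thesis by (simp add: W_def)
qed

text \<open>Linearity over functions turns into dependence on the value at \<open>p\<close> only: near \<open>p\<close> the field is a
  combination of the coordinate frame, and all coefficients vanish at \<open>p\<close>.\<close>
lemma tensorial_vanish:
  fixes T :: "('m \<Rightarrow> real ^ 'd) \<Rightarrow> 'v::real_vector"
  assumes add: "\<And>U X Y. p \<in> U \<Longrightarrow> X \<in> vec_fields A U \<Longrightarrow> Y \<in> vec_fields A U \<Longrightarrow> T (\<lambda>q. X q + Y q) = T X + T Y"
    and scale: "\<And>U f X. p \<in> U \<Longrightarrow> X \<in> vec_fields A U \<Longrightarrow> smooth_fun_on A U f \<Longrightarrow> T (\<lambda>q. f q *\<^sub>R X q) = f p *\<^sub>R T X"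
    and X: "p \<in> U" "X \<in> vec_fields A U" "X p = 0"
  shows "T X = 0"
proof -
  define c where "c = chart_at A p"
  have c: "c \<in> A" "p \<in> fst c" by (simp_all add: c_def chart_at_in_atlas in_chart_at)
  let ?V = "fst c \<inter> U"
  have V: "open ?V" "p \<in> ?V" using c X vec_fields_open open_chart_domain by blast+
  let ?a = "\<lambda>b q. components A c q (X q) \<bullet> b"
  have a: "smooth_fun_on A ?V (?a b)" for b using vec_field_component_smooth[OF X(2) c(1)] .
  have E: "coord_field A c b \<in> vec_fields A ?V" for b
    using vec_fields_subset[OF coord_field_vec_field[OF c(1)] V(1)] by blast
  have aE: "(\<lambda>q. ?a b q *\<^sub>R coord_field A c b q) \<in> vec_fields A ?V" for b
    by (rule vec_fields_scale[OF a E])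
  have zero: "T (\<lambda>q. 0) = 0"
    using scale[OF V(2) E smooth_fun_on_const[of ?V 0]] by simp
  have sum: "T (\<lambda>q. \<Sum>b\<in>B. ?a b q *\<^sub>R coord_field A c b q) = (\<Sum>b\<in>B. ?a b p *\<^sub>R T (coord_field A c b))"
    if "finite B" for B
    using that
  proof induction
    case (insert b B)
    then show ?case
      using add[OF V(2) aE vec_fields_sum[where X = "\<lambda>b q. ?a b q *\<^sub>R coord_field A c b q" and I = B, OF aE V(1)]] scale[OF V(2) E a] by simp
  qed (simp add: zero)
  have "T X = T (\<lambda>q. \<Sum>b\<in>Basis. ?a b q *\<^sub>R coord_field A c b q)"
  proof (rule local_operator_eq[where T = T and p = p and V = ?V])
    show "X \<in> vec_fields A ?V" using vec_fields_subset[OF X(2) V(1)] by blast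
    show "X q = (\<Sum>b\<in>Basis. ?a b q *\<^sub>R coord_field A c b q)" if "q \<in> ?V" for q
      using vec_field_expansion[OF c(1)] that by blast
    show "T (\<lambda>q. f q *\<^sub>R X q) = 0" if "p \<in> U" "X \<in> vec_fields A U" "smooth_fun_on A U f" "\<And>q. q \<in> U \<Longrightarrow> f q = 0" for U f X
      using scale[OF that(1-3)] that by simp
    show "T (\<lambda>q. X q + Y q) = T X + T Y" if "p \<in> U" "X \<in> vec_fields A U" "Y \<in> vec_fields A U" for U X Y
      by (rule add[OF that])
    show "(\<lambda>q. \<Sum>b\<in>Basis. ?a b q *\<^sub>R coord_field A c b q) \<in> vec_fields A ?V"
      by (rule vec_fields_sum[OF aE V(1)])
  qed (rule V(2))
  also have "\<dots> = 0" using sum[OF finite_Basis] X(3) linear_0[OF linear_components[OF c]] by simp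
  finally show ?thesis .
qed

lemma tensorial_eq:
  fixes T :: "('m \<Rightarrow> real ^ 'd) \<Rightarrow> 'v::real_vector"
  assumes add: "\<And>U X Y. p \<in> U \<Longrightarrow> X \<in> vec_fields A U \<Longrightarrow> Y \<in> vec_fields A U \<Longrightarrow> T (\<lambda>q. X q + Y q) = T X + T Y"
    and scale: "\<And>U f X. p \<in> U \<Longrightarrow> X \<in> vec_fields A U \<Longrightarrow> smooth_fun_on A U f \<Longrightarrow> T (\<lambda>q. f q *\<^sub>R X q) = f p *\<^sub>R T X"
    and X: "p \<in> U" "X \<in> vec_fields A U" "p \<in> V" "Y \<in> vec_fields A V" "X p = Y p"
  shows "T X = T Y"
proof -
  let ?W = "U \<inter> V"
  have W: "open ?W" using X vec_fields_open by blast
  have XY: "X \<in> vec_fields A ?W" "Y \<in> vec_fields A ?W"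
    using vec_fields_subset[OF _ W] X by blast+
  have "T (\<lambda>q. X q - Y q) = 0"
    by (rule tensorial_vanish[where T = T and p = p and U = ?W]) (use add scale X XY vec_fields_diff in auto)
  then show ?thesis using add[of ?W Y "\<lambda>q. X q - Y q"] XY vec_fields_diff X by simp
qed

lemma differential_zero_imp_constant:
  assumes f: "smooth_fun_on A UNIV f" and d: "\<And>p v. differential A f p v = 0"
    and conn: "connected (UNIV :: 'm set)"
  shows "f p = f q"
proof (rule connected_local_const[OF conn UNIV_I UNIV_I], intro ballI)
  fix p :: 'm
  define c where "c = chart_at A p"
  have c: "c \<in> A" "p \<in> fst c" by (simp_all add: c_def chart_at_in_atlas in_chart_at)
  have o: "open (snd c ` fst c)" using open_chart_image[OF c(1) open_UNIV] by simp
  then obtain r where r: "r > 0" "ball (snd c p) r \<subseteq> snd c ` fst c" using c(2) openE by blast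
  let ?F = "\<lambda>x. f (chart_inv c x)"
  have "(?F has_derivative (\<lambda>v. 0)) (at x)" if x: "x \<in> ball (snd c p) r" for x
  proof -
    obtain q where q: "q \<in> fst c" "x = snd c q" using x r(2) by blast
    have "frechet_derivative ?F (at x) v = 0" for v
      using differential_in_chart[OF f UNIV_I q(1) c(1), of "coord_field A c v q"] d q components_coord_field[OF c(1)]
      by simp
    then have "frechet_derivative ?F (at x) = (\<lambda>v. 0)" by (rule ext)
    then show ?thesis using smooth_fun_chart_derivative[OF f UNIV_I c(1) q(1)] q(2) by simp
  qed
  then have const: "?F x = ?F (snd c p)" if "x \<in> ball (snd c p) r" for x
    using has_derivative_zero_unique[of "ball (snd c p) r" ?F x "snd c p"] that r(1)
    by (auto intro: has_derivative_at_withinI)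
  let ?N = "fst c \<inter> snd c -` ball (snd c p) r"
  have "open ?N"
    using chart_homeomorphism[OF c(1)] open_chart_domain[OF c(1)]
    by (intro continuous_open_preimage) (auto simp: homeomorphism_def)
  moreover have "p \<in> ?N" using c r by simp
  moreover have "f p = f q" if "q \<in> ?N" for q
    using const[of "snd c q"] that c by (simp add: chart_inv_left)
  ultimately show "\<forall>\<^sub>F q in at p within UNIV. f p = f q"
    unfolding eventually_at_topological by blast
qed

end

section \<open>Traces\<close>

lemma trace_matrix: "trace (matrix f) = (\<Sum>k\<in>UNIV. f (axis k 1) $ k)"
  by (simp add: trace_def matrix_def)

lemma trace_matrix_conjugate:
  fixes T C C' :: "real ^ 'd \<Rightarrow> real ^ 'd"
  assumes "linear T" "linear C" "linear C'" "\<And>v. C' (C v) = v"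
  shows "trace (matrix T) = trace (matrix (\<lambda>v. C (T (C' v))))"
proof -
  have CT: "linear (C \<circ> T)" using linear_compose[OF assms(1,2)] .
  have "trace (matrix T) = trace (matrix (C' \<circ> (C \<circ> T)))"
    using assms(4) by (simp add: o_def)
  also have "\<dots> = trace (matrix C' ** matrix (C \<circ> T))"
    by (simp only: matrix_compose[OF CT assms(3)])
  also have "\<dots> = trace (matrix ((C \<circ> T) \<circ> C'))"
    by (simp only: matrix_compose[OF assms(3) CT] trace_mul_sym[of "matrix C'"])
  finally show ?thesis by (simp add: o_def)
qed

lemma linear_eq_sum_axis:
  fixes L :: "real ^ 'd \<Rightarrow> real"
  assumes "linear L"
  shows "L w = (\<Sum>k\<in>UNIV. L (axis k 1) * w $ k)"
proof -
  have "L w = L (\<Sum>k\<in>UNIV. w $ k *\<^sub>R axis k 1)"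
    by (simp add: scalar_mult_eq_scaleR[symmetric] basis_expansion)
  also have "\<dots> = (\<Sum>k\<in>UNIV. L (axis k 1) * w $ k)"
    by (simp add: linear_sum[OF assms] linear_scale[OF assms] mult.commute)
  finally show ?thesis .
qed

text \<open>In a pseudo-orthonormal basis \<open>e\<close> with signs \<open>\<epsilon>\<close> one has \<open>S v = \<Sum> \<epsilon>\<^sub>i B(v, e\<^sub>i) S e\<^sub>i\<close>, a sum of operators of rank
  one, so the trace of \<open>S\<close> is \<open>\<Sum> \<epsilon>\<^sub>i B(S e\<^sub>i, e\<^sub>i)\<close>.\<close>
lemma trace_skew_eq_0:
  fixes B :: "real ^ 'd \<Rightarrow> real ^ 'd \<Rightarrow> real"
  assumes B: "bilinear B" and sig: "has_signature B r s"
    and S: "linear S" and skew: "\<And>z. B (S z) z = 0"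
  shows "trace (matrix S) = 0"
proof -
  obtain e where e: "span (e ` {..<r + s}) = UNIV"
      "\<And>i j. i < r + s \<Longrightarrow> j < r + s \<Longrightarrow> B (e i) (e j) = (if i \<noteq> j then 0 else if i < r then 1 else -1)"
    using sig unfolding has_signature_def by blast
  define \<epsilon> :: "nat \<Rightarrow> real" where "\<epsilon> = (\<lambda>i. if i < r then 1 else -1)"
  have lB: "linear (\<lambda>x. B x y)" for y using B by (simp add: bilinear_def)
  let ?L = "\<lambda>v. \<Sum>i<r + s. (\<epsilon> i * B v (e i)) *\<^sub>R e i"
  have linL: "linear ?L"
    by (intro linear_compose_sum ballI linearI)
      (simp_all add: linear_add[OF lB] linear_scale[OF lB] algebra_simps)
  have Le: "?L (e j) = e j" if "j < r + s" for j
  proof -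
    have "?L (e j) = (\<Sum>i<r + s. if i = j then e j else 0)"
      by (intro sum.cong) (use that e in \<open>auto simp: \<epsilon>_def\<close>)
    then show ?thesis using that by simp
  qed
  have expand: "v = ?L v" for v
  proof -
    have "id v = ?L v"
      by (rule linear_eq_on_span[OF linear_id linL, of "e ` {..<r + s}"]) (use Le e(1) in auto)
    then show ?thesis by simp
  qed
  have Sv: "S v = (\<Sum>i<r + s. (\<epsilon> i * B v (e i)) *\<^sub>R S (e i))" for v
  proof -
    have "S v = S (?L v)" using expand by simp
    then show ?thesis by (simp add: linear_sum[OF S] linear_scale[OF S])
  qed
  have "trace (matrix S) = (\<Sum>k\<in>UNIV. \<Sum>i<r + s. \<epsilon> i * (B (axis k 1) (e i) * S (e i) $ k))"
    unfolding trace_matrix by (subst Sv) (simp add: mult.assoc)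
  also have "\<dots> = (\<Sum>i<r + s. \<epsilon> i * B (S (e i)) (e i))"
    by (subst sum.swap) (simp add: linear_eq_sum_axis[OF lB, symmetric] sum_distrib_left[symmetric])
  finally show ?thesis using skew by simp
qed

section \<open>Curvature of a torsion-free connection\<close>

locale torsion_free_connection = smooth_manifold A
  for A :: "('m::{t2_space, second_countable_topology}, 'd::finite) chart set" +
  fixes D :: "'m \<Rightarrow> real ^ 'd \<Rightarrow> ('m \<Rightarrow> real ^ 'd) \<Rightarrow> real ^ 'd"
  assumes affine: "affine_connection A D" and torsion: "torsion_free A D"
begin

lemmas affine_axioms = affine[unfolded affine_connection_def]

lemma connection_vec_field:
  assumes "X \<in> vec_fields A U" "Y \<in> vec_fields A U"
  shows "(\<lambda>p. D p (X p) Y) \<in> vec_fields A U"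
  using affine_axioms[THEN conjunct1, rule_format, OF assms] vec_fields_open[OF assms(1)]
  by (simp add: vec_fields_def)

lemma connection_linear:
  assumes "Y \<in> vec_fields A U" "p \<in> U"
  shows "linear (\<lambda>v. D p v Y)"
  by (rule affine_axioms[THEN conjunct2, THEN conjunct1, rule_format, OF assms])

lemma connection_add:
  assumes "Y \<in> vec_fields A U" "Z \<in> vec_fields A U" "p \<in> U"
  shows "D p v (\<lambda>q. Y q + Z q) = D p v Y + D p v Z"
  by (rule affine_axioms[THEN conjunct2, THEN conjunct2, THEN conjunct1, rule_format, OF assms])

lemma connection_scale:
  assumes "smooth_fun_on A U f" "Y \<in> vec_fields A U" "p \<in> U"
  shows "D p v (\<lambda>q. f q *\<^sub>R Y q) = differential A f p v *\<^sub>R Y p + f p *\<^sub>R D p v Y"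
  by (rule affine_axioms[THEN conjunct2, THEN conjunct2, THEN conjunct2, rule_format, OF assms(2,1,3)])

lemma connection_diff:
  assumes "Y \<in> vec_fields A U" "Z \<in> vec_fields A U" "p \<in> U"
  shows "D p v (\<lambda>q. Y q - Z q) = D p v Y - D p v Z"
  using connection_add[OF assms(2) vec_fields_diff[OF assms(1,2)] assms(3)] by (simp add: algebra_simps)

lemma connection_cong:
  assumes V: "p \<in> V" "X \<in> vec_fields A V" "Y \<in> vec_fields A V" "\<And>q. q \<in> V \<Longrightarrow> X q = Y q"
  shows "D p v X = D p v Y"
proof (rule local_operator_eq[where T = "D p v" and p = p, OF _ _ V])
  fix U f X assume *: "p \<in> U" "X \<in> vec_fields A U" "smooth_fun_on A U f" and 0: "\<And>q. q \<in> U \<Longrightarrow> f q = 0"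
  have "differential A f p = differential A (\<lambda>_. 0) p"
    by (rule differential_cong[OF vec_fields_open[OF *(2)] *(1) 0])
  then show "D p v (\<lambda>q. f q *\<^sub>R X q) = 0"
    using connection_scale[OF *(3,2,1)] 0[OF *(1)] differential_const by simp
qed (rule connection_add)

lemma bracket_eq:
  "X \<in> vec_fields A U \<Longrightarrow> Y \<in> vec_fields A U \<Longrightarrow> p \<in> U \<Longrightarrow>
   lie_bracket A X Y p = D p (X p) Y - D p (Y p) X"
  using torsion unfolding torsion_free_def by metis

text \<open>Vanishing torsion rewrites the bracket in the curvature by covariant derivatives. In this form the
  linearity over functions in the first slot is visible from the axioms of a connection.\<close>
lemma curvature_eq:
  assumes "X \<in> vec_fields A U" "Y \<in> vec_fields A U" "Z \<in> vec_fields A U" "p \<in> U"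
  shows "curvature A D X Y Z p = D p (X p) (\<lambda>q. D q (Y q) Z) - D p (Y p) (\<lambda>q. D q (X q) Z)
            - (D p (D p (X p) Y) Z - D p (D p (Y p) X) Z)"
  using assms by (simp add: curvature_def bracket_eq linear_diff[OF connection_linear])

lemma curvature_antisym:
  assumes "X \<in> vec_fields A U" "Y \<in> vec_fields A U" "Z \<in> vec_fields A U" "p \<in> U"
  shows "curvature A D X Y Z p = - curvature A D Y X Z p"
  using assms by (simp add: curvature_eq)

lemma curvature_add1:
  assumes X: "X \<in> vec_fields A U" and X': "X' \<in> vec_fields A U" and Y: "Y \<in> vec_fields A U"
    and Z: "Z \<in> vec_fields A U" and p: "p \<in> U"
  shows "curvature A D (\<lambda>q. X q + X' q) Y Z p = curvature A D X Y Z p + curvature A D X' Y Z p"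
proof -
  note lin = linear_add[OF connection_linear[OF _ p]] linear_diff[OF connection_linear[OF _ p]]
  note DXZ = connection_vec_field[OF X Z] connection_vec_field[OF X' Z]
  have "D p (Y p) (\<lambda>q. D q (X q + X' q) Z) = D p (Y p) (\<lambda>q. D q (X q) Z + D q (X' q) Z)"
    by (rule connection_cong[OF p connection_vec_field[OF vec_fields_add[OF X X'] Z] vec_fields_add[OF DXZ]])
      (simp add: linear_add[OF connection_linear[OF Z]])
  then show ?thesis
    unfolding curvature_eq[OF X Y Z p] curvature_eq[OF X' Y Z p] curvature_eq[OF vec_fields_add[OF X X'] Y Z p]
    using lin(1)[OF connection_vec_field[OF Y Z]] lin(1)[OF Y] lin(1)[OF Z]
      connection_add[OF DXZ p] connection_add[OF X X' p] by simp
qed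

lemma curvature_scale1:
  assumes X: "X \<in> vec_fields A U" and f: "smooth_fun_on A U f" and Y: "Y \<in> vec_fields A U"
    and Z: "Z \<in> vec_fields A U" and p: "p \<in> U"
  shows "curvature A D (\<lambda>q. f q *\<^sub>R X q) Y Z p = f p *\<^sub>R curvature A D X Y Z p"
proof -
  note lin = linear_add[OF connection_linear[OF _ p]] linear_scale[OF connection_linear[OF _ p]]
  note DXZ = connection_vec_field[OF X Z]
  have "D p (Y p) (\<lambda>q. D q (f q *\<^sub>R X q) Z) = D p (Y p) (\<lambda>q. f q *\<^sub>R D q (X q) Z)"
    by (rule connection_cong[OF p connection_vec_field[OF vec_fields_scale[OF f X] Z] vec_fields_scale[OF f DXZ]])
      (simp add: linear_scale[OF connection_linear[OF Z]])
  then show ?thesis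
    unfolding curvature_eq[OF X Y Z p] curvature_eq[OF vec_fields_scale[OF f X] Y Z p]
    using lin(2)[OF connection_vec_field[OF Y Z]] lin(2)[OF Y] lin[OF Z]
      connection_scale[OF f DXZ p] connection_scale[OF f X p] by (simp add: algebra_simps)
qed

lemma curvature_add3:
  assumes X: "X \<in> vec_fields A U" and Y: "Y \<in> vec_fields A U"
    and Z: "Z \<in> vec_fields A U" and Z': "Z' \<in> vec_fields A U" and p: "p \<in> U"
  shows "curvature A D X Y (\<lambda>q. Z q + Z' q) p = curvature A D X Y Z p + curvature A D X Y Z' p"
proof -
  have "D p v (\<lambda>q. D q (X q) (\<lambda>q. Z q + Z' q)) = D p v (\<lambda>q. D q (X q) Z) + D p v (\<lambda>q. D q (X q) Z')"
    if X: "X \<in> vec_fields A U" for X v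
  proof -
    note DXZ = connection_vec_field[OF X Z] connection_vec_field[OF X Z']
    have "D p v (\<lambda>q. D q (X q) (\<lambda>q. Z q + Z' q)) = D p v (\<lambda>q. D q (X q) Z + D q (X q) Z')"
      by (rule connection_cong[OF p connection_vec_field[OF X vec_fields_add[OF Z Z']] vec_fields_add[OF DXZ]])
        (rule connection_add[OF Z Z'])
    then show ?thesis using connection_add[OF DXZ p] by simp
  qed
  from this[OF X] this[OF Y] show ?thesis
    unfolding curvature_eq[OF X Y Z p] curvature_eq[OF X Y Z' p] curvature_eq[OF X Y vec_fields_add[OF Z Z'] p]
    using connection_add[OF Z Z' p] by simp
qed

text \<open>In the third slot the second derivatives \<open>X (Y f) - Y (X f)\<close> appear; they cancel exactly because the
  bracket acts as the commutator, which is why the curvature is kept in its original form here.\<close>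
lemma curvature_scale3:
  assumes X: "X \<in> vec_fields A U" and Y: "Y \<in> vec_fields A U"
    and Z: "Z \<in> vec_fields A U" and f: "smooth_fun_on A U f" and p: "p \<in> U"
  shows "curvature A D X Y (\<lambda>q. f q *\<^sub>R Z q) p = f p *\<^sub>R curvature A D X Y Z p"
proof -
  have U: "open U" using X vec_fields_open by blast
  have "D p v (\<lambda>q. D q (X q) (\<lambda>q. f q *\<^sub>R Z q))
      = differential A (\<lambda>q. differential A f q (X q)) p v *\<^sub>R Z p + differential A f p (X p) *\<^sub>R D p v Z
        + (differential A f p v *\<^sub>R D p (X p) Z + f p *\<^sub>R D p v (\<lambda>q. D q (X q) Z))"
    if X: "X \<in> vec_fields A U" for X v
  proof -
    note DXZ = connection_vec_field[OF X Z]
    note dfX = smooth_differential[OF f X]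
    have "D p v (\<lambda>q. D q (X q) (\<lambda>q. f q *\<^sub>R Z q))
        = D p v (\<lambda>q. differential A f q (X q) *\<^sub>R Z q + f q *\<^sub>R D q (X q) Z)"
      by (rule connection_cong[OF p connection_vec_field[OF X vec_fields_scale[OF f Z]]
            vec_fields_add[OF vec_fields_scale[OF dfX Z] vec_fields_scale[OF f DXZ]]])
        (rule connection_scale[OF f Z])
    then show ?thesis
      using connection_add[OF vec_fields_scale[OF dfX Z] vec_fields_scale[OF f DXZ] p]
        connection_scale[OF dfX Z p] connection_scale[OF f DXZ p] by simp
  qed
  from this[OF X] this[OF Y] show ?thesis
    unfolding curvature_def
    by (simp add: connection_scale[OF f Z p] lie_bracket_commutator[OF X Y p U p f]
        algebra_simps)
qed

lemma curvature_depends_on_values1: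
  assumes X: "X \<in> vec_fields A U" "X' \<in> vec_fields A U" "X p = X' p"
    and YZ: "Y \<in> vec_fields A U" "Z \<in> vec_fields A U" and p: "p \<in> U"
  shows "curvature A D X Y Z p = curvature A D X' Y Z p"
proof (rule tensorial_eq[where T = "\<lambda>X. curvature A D X Y Z p", OF _ _ p X(1) p X(2,3)])
  fix V X X' assume V: "p \<in> V" "X \<in> vec_fields A V"
  have W: "open (U \<inter> V)" using V(2) YZ vec_fields_open by blast
  note sub = vec_fields_subset[OF _ W]
  { assume "X' \<in> vec_fields A V"
    then show "curvature A D (\<lambda>q. X q + X' q) Y Z p = curvature A D X Y Z p + curvature A D X' Y Z p"
      using curvature_add1[of X "U \<inter> V" X' Y Z p] sub V p YZ by blast }
  { fix f assume "smooth_fun_on A V f"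
    then show "curvature A D (\<lambda>q. f q *\<^sub>R X q) Y Z p = f p *\<^sub>R curvature A D X Y Z p"
      using curvature_scale1[of X "U \<inter> V" f Y Z p] sub V p YZ smooth_fun_on_subset[of V f "U \<inter> V"] by blast }
qed

lemma curvature_depends_on_values3:
  assumes Z: "Z \<in> vec_fields A U" "Z' \<in> vec_fields A U" "Z p = Z' p"
    and XY: "X \<in> vec_fields A U" "Y \<in> vec_fields A U" and p: "p \<in> U"
  shows "curvature A D X Y Z p = curvature A D X Y Z' p"
proof (rule tensorial_eq[where T = "\<lambda>Z. curvature A D X Y Z p", OF _ _ p Z(1) p Z(2,3)])
  fix V Z Z' assume V: "p \<in> V" "Z \<in> vec_fields A V"
  have W: "open (U \<inter> V)" using V(2) XY vec_fields_open by blast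
  note sub = vec_fields_subset[OF _ W]
  { assume "Z' \<in> vec_fields A V"
    then show "curvature A D X Y (\<lambda>q. Z q + Z' q) p = curvature A D X Y Z p + curvature A D X Y Z' p"
      using curvature_add3[of X "U \<inter> V" Y Z Z' p] sub V p XY by blast }
  { fix f assume "smooth_fun_on A V f"
    then show "curvature A D X Y (\<lambda>q. f q *\<^sub>R Z q) p = f p *\<^sub>R curvature A D X Y Z p"
      using curvature_scale3[of X "U \<inter> V" Y Z f p] sub V p XY smooth_fun_on_subset[of V f "U \<inter> V"] by blast }
qed

text \<open>The fields are exchanged one at a time: the first slot and the third by tensoriality, the second by
  antisymmetry. This justifies the definite description in \<open>curvature_at\<close>.\<close>
lemma curvature_at_eq:
  assumes XYZ: "X \<in> vec_fields A U" "Y \<in> vec_fields A U" "Z \<in> vec_fields A U" and p: "p \<in> U"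
  shows "curvature_at A D p (X p) (Y p) (Z p) = curvature A D X Y Z p"
  unfolding curvature_at_def
proof (rule the_equality)
  show "\<forall>V. \<forall>X'\<in>vec_fields A V. \<forall>Y'\<in>vec_fields A V. \<forall>Z'\<in>vec_fields A V.
      p \<in> V \<and> X' p = X p \<and> Y' p = Y p \<and> Z' p = Z p \<longrightarrow> curvature A D X Y Z p = curvature A D X' Y' Z' p"
  proof (intro allI ballI impI)
    fix V X' Y' Z'
    assume V: "X' \<in> vec_fields A V" "Y' \<in> vec_fields A V" "Z' \<in> vec_fields A V"
      and eq: "p \<in> V \<and> X' p = X p \<and> Y' p = Y p \<and> Z' p = Z p"
    let ?W = "U \<inter> V"
    have W: "open ?W" "p \<in> ?W" using XYZ(1) V(1) vec_fields_open p eq by blast+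
    note sub = vec_fields_subset[OF _ W(1)]
    have w: "X \<in> vec_fields A ?W" "Y \<in> vec_fields A ?W" "Z \<in> vec_fields A ?W"
      "X' \<in> vec_fields A ?W" "Y' \<in> vec_fields A ?W" "Z' \<in> vec_fields A ?W"
      using sub XYZ V by blast+
    have "curvature A D X Y Z p = curvature A D X' Y Z p"
      using curvature_depends_on_values1[of X ?W X' p Y Z] w W eq by simp
    also have "\<dots> = curvature A D X' Y' Z p"
      using curvature_depends_on_values1[of Y ?W Y' p X' Z] w W eq
        curvature_antisym[of X' ?W Y Z p] curvature_antisym[of X' ?W Y' Z p] by simp
    also have "\<dots> = curvature A D X' Y' Z' p"
      using curvature_depends_on_values3[of Z ?W Z' p X' Y'] w W eq by simp
    finally show "curvature A D X Y Z p = curvature A D X' Y' Z' p" .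
  qed
qed (use XYZ p in blast)

lemma curvature_at_algebra:
  shows curvature_at_add1: "curvature_at A D p (x + x') y z = curvature_at A D p x y z + curvature_at A D p x' y z"
    and curvature_at_scale1: "curvature_at A D p (a *\<^sub>R x) y z = a *\<^sub>R curvature_at A D p x y z"
    and curvature_at_add3: "curvature_at A D p x y (z + z') = curvature_at A D p x y z + curvature_at A D p x y z'"
    and curvature_at_scale3: "curvature_at A D p x y (a *\<^sub>R z) = a *\<^sub>R curvature_at A D p x y z"
    and curvature_at_antisym: "curvature_at A D p y x z = - curvature_at A D p x y z"
proof -
  let ?U = "fst (chart_at A p)"
  obtain X X' Y Z Z' where v: "X \<in> vec_fields A ?U" "X p = x" "X' \<in> vec_fields A ?U" "X' p = x'"
    "Y \<in> vec_fields A ?U" "Y p = y" "Z \<in> vec_fields A ?U" "Z p = z" "Z' \<in> vec_fields A ?U" "Z' p = z'"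
    using vec_field_through by metis
  note p = in_chart_at
  show "curvature_at A D p (x + x') y z = curvature_at A D p x y z + curvature_at A D p x' y z"
    using curvature_add1[OF v(1,3,5,7) p] curvature_at_eq[OF vec_fields_add[OF v(1,3)] v(5,7) p]
      curvature_at_eq[OF v(1,5,7) p] curvature_at_eq[OF v(3,5,7) p] v by simp
  show "curvature_at A D p (a *\<^sub>R x) y z = a *\<^sub>R curvature_at A D p x y z"
    using curvature_scale1[OF v(1) smooth_fun_on_const v(5,7) p]
      curvature_at_eq[OF vec_fields_scale[OF smooth_fun_on_const v(1)] v(5,7) p]
      curvature_at_eq[OF v(1,5,7) p] v by simp
  show "curvature_at A D p x y (z + z') = curvature_at A D p x y z + curvature_at A D p x y z'"
    using curvature_add3[OF v(1,5,7,9) p] curvature_at_eq[OF v(1,5) vec_fields_add[OF v(7,9)] p]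
      curvature_at_eq[OF v(1,5,7) p] curvature_at_eq[OF v(1,5,9) p] v by simp
  show "curvature_at A D p x y (a *\<^sub>R z) = a *\<^sub>R curvature_at A D p x y z"
    using curvature_scale3[OF v(1,5,7) smooth_fun_on_const p]
      curvature_at_eq[OF v(1,5) vec_fields_scale[OF smooth_fun_on_const v(7)] p]
      curvature_at_eq[OF v(1,5,7) p] v by simp
  show "curvature_at A D p y x z = - curvature_at A D p x y z"
    using curvature_antisym[OF v(1,5,7) p] curvature_at_eq[OF v(1,5,7) p] curvature_at_eq[OF v(5,1,7) p] v by simp
qed

lemma linear_curvature_at1: "linear (\<lambda>x. curvature_at A D p x y z)"
  by (intro linearI curvature_at_add1 curvature_at_scale1)

lemma linear_curvature_at3: "linear (\<lambda>z. curvature_at A D p x y z)"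
  by (intro linearI curvature_at_add3 curvature_at_scale3)

lemma linear_curvature_at2: "linear (\<lambda>y. curvature_at A D p x y z)"
  using curvature_at_antisym[of p _ x z] linear_compose_neg[OF linear_curvature_at1, of p x z] by simp

text \<open>By tensoriality the three vectors may be extended by coordinate fields \<open>X, Y, Z\<close>. These commute,
  so \<open>\<nabla>\<^sub>Y Z = \<nabla>\<^sub>Z Y\<close> and so on, and the six second derivatives cancel in pairs.\<close>
lemma first_bianchi:
  "curvature_at A D p x y z + curvature_at A D p y z x + curvature_at A D p z x y = 0"
proof -
  define c where "c = chart_at A p"
  have c: "c \<in> A" "p \<in> fst c" by (simp_all add: c_def chart_at_in_atlas in_chart_at)
  define E where "E = (\<lambda>w. coord_field A c (components A c p w))"
  have E: "E w \<in> vec_fields A (fst c)" "E w p = w" for w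
    by (simp_all add: E_def coord_field_vec_field coord_field_components c)
  have comm: "D q (E u q) (E w) = D q (E w q) (E u)" if "q \<in> fst c" for q u w
    using bracket_eq[OF E(1) E(1) that] lie_bracket_coord_fields[OF c(1) that] by (simp add: E_def)
  have D2: "D p v (\<lambda>q. D q (E u q) (E w)) = D p v (\<lambda>q. D q (E w q) (E u))" for u v w
    by (rule connection_cong[OF c(2) connection_vec_field connection_vec_field])
      (use E comm in auto)
  have R: "curvature_at A D p u v w = D p u (\<lambda>q. D q (E v q) (E w)) - D p v (\<lambda>q. D q (E u q) (E w))" for u v w
    using curvature_at_eq[OF E(1)[of u] E(1)[of v] E(1)[of w] c(2)] curvature_eq[OF E(1)[of u] E(1)[of v] E(1)[of w] c(2)]
      comm[OF c(2), of u v] by (simp add: E)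
  show ?thesis unfolding R using D2 by (simp add: algebra_simps)
qed

lemma curvature_vec_field:
  assumes X: "X \<in> vec_fields A U" and Y: "Y \<in> vec_fields A U" and Z: "Z \<in> vec_fields A U"
  shows "(\<lambda>q. D q (X q) (\<lambda>q. D q (Y q) Z) - D q (Y q) (\<lambda>q. D q (X q) Z)
            - (D q (D q (X q) Y) Z - D q (D q (Y q) X) Z)) \<in> vec_fields A U"
  by (intro vec_fields_diff connection_vec_field assms)

text \<open>The Ricci tensor is a trace in the preferred charts, which vary from point to point without any
  continuity. Conjugating with the components of a fixed chart expresses the same trace through the
  coordinate frame, where smoothness can be read off.\<close>
lemma ricci_eq_chart_trace:
  assumes Y: "Y \<in> vec_fields A U" and Z: "Z \<in> vec_fields A U" and c: "c \<in> A" and q: "q \<in> fst c \<inter> U"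
  shows "ricci A D q (Y q) (Z q)
    = (\<Sum>k\<in>UNIV. components A c q (curvature A D (coord_field A c (axis k 1)) Y Z q) \<bullet> axis k 1)"
proof -
  have V: "open (fst c \<inter> U)" using open_chart_domain[OF c] vec_fields_open[OF Y] by blast
  note sub = vec_fields_subset[OF _ V]
  have qc: "q \<in> fst c" using q by blast
  have "ricci A D q (Y q) (Z q)
      = trace (matrix (\<lambda>w. components A c q (curvature_at A D q (coord_field A c w q) (Y q) (Z q))))"
    unfolding ricci_def
    by (rule trace_matrix_conjugate[OF linear_curvature_at1 linear_components[OF c qc]
         linear_coord_field[OF c qc] coord_field_components[OF c qc]])
  also have "\<dots> = (\<Sum>k\<in>UNIV. components A c q (curvature A D (coord_field A c (axis k 1)) Y Z q) \<bullet> axis k 1)"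
    using curvature_at_eq[OF sub[OF coord_field_vec_field[OF c]] sub[OF Y] sub[OF Z] q]
    by (simp add: trace_matrix inner_axis)
  finally show ?thesis .
qed

lemma ricci_smooth:
  assumes Y: "Y \<in> vec_fields A U" and Z: "Z \<in> vec_fields A U"
  shows "smooth_fun_on A U (\<lambda>q. ricci A D q (Y q) (Z q))"
proof (rule smooth_fun_on_chartwise)
  fix c assume c: "c \<in> A"
  let ?V = "fst c \<inter> U"
  have V: "open ?V" using open_chart_domain[OF c] vec_fields_open[OF Y] by blast
  note sub = vec_fields_subset[OF _ V]
  let ?E = "\<lambda>k. coord_field A c (axis k 1)"
  let ?R = "\<lambda>k q. D q (?E k q) (\<lambda>q. D q (Y q) Z) - D q (Y q) (\<lambda>q. D q (?E k q) Z)
            - (D q (D q (?E k q) Y) Z - D q (D q (Y q) (?E k)) Z)"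
  have E: "?E k \<in> vec_fields A ?V" for k using sub[OF coord_field_vec_field[OF c]] by blast
  have YZ: "Y \<in> vec_fields A ?V" "Z \<in> vec_fields A ?V" using sub[OF Y] sub[OF Z] by auto
  have sm: "smooth_fun_on A ?V (\<lambda>q. \<Sum>k\<in>UNIV. components A c q (?R k q) \<bullet> axis k 1)"
    using vec_field_component_smooth[OF curvature_vec_field[OF E YZ] c]
    by (intro smooth_fun_on_sum V) (simp add: Int_assoc[symmetric])
  show "smooth_fun_on A ?V (\<lambda>q. ricci A D q (Y q) (Z q))"
    by (rule smooth_fun_on_cong[OF V _ sm])
      (simp add: ricci_eq_chart_trace[OF Y Z c] curvature_eq[OF E YZ])
qed

lemma ricci_bilinear: "bilinear (ricci A D p)"
  unfolding bilinear_def ricci_def trace_matrix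
  by (auto intro!: linear_compose_sum linearI
      simp: curvature_at_add3 curvature_at_scale3 linear_add[OF linear_curvature_at2] linear_scale[OF linear_curvature_at2])

end

section \<open>The Levi-Civita connection\<close>

locale levi_civita_manifold = torsion_free_connection A D
  for A :: "('m::{t2_space, second_countable_topology}, 'd::finite) chart set" and D +
  fixes g :: "'m \<Rightarrow> real ^ 'd \<Rightarrow> real ^ 'd \<Rightarrow> real" and r s :: nat
  assumes metric: "pseudo_riemannian_metric A r s g" and metric_parallel: "parallel A D g"
begin

lemma metric_bilinear: "bilinear (g p)"
  using metric by (simp add: pseudo_riemannian_metric_def smooth_bilinear_def)

lemma metric_sym: "g p x y = g p y x"
  using metric by (simp add: pseudo_riemannian_metric_def)

lemma metric_smooth: "X \<in> vec_fields A U \<Longrightarrow> Y \<in> vec_fields A U \<Longrightarrow> smooth_fun_on A U (\<lambda>p. g p (X p) (Y p))"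
  using metric by (simp add: pseudo_riemannian_metric_def smooth_bilinear_def)

lemma metric_compatible:
  "Y \<in> vec_fields A U \<Longrightarrow> Z \<in> vec_fields A U \<Longrightarrow> p \<in> U \<Longrightarrow>
   differential A (\<lambda>q. g q (Y q) (Z q)) p v = g p (D p v Y) (Z p) + g p (Y p) (D p v Z)"
  using metric_parallel unfolding parallel_def cov_deriv_bilinear_def by (simp add: algebra_simps)

text \<open>The function \<open>g(Z,Z)\<close> satisfies \<open>X (Y g(Z,Z)) - Y (X g(Z,Z)) = [X,Y] g(Z,Z)\<close>. Metric compatibility
  turns this identity into \<open>2 g(R(X,Y)Z, Z) = 0\<close>.\<close>
lemma curvature_skew: "g p (curvature_at A D p x y z) z = 0"
proof -
  let ?U = "fst (chart_at A p)"
  obtain X Y Z where v: "X \<in> vec_fields A ?U" "X p = x" "Y \<in> vec_fields A ?U" "Y p = y"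
    "Z \<in> vec_fields A ?U" "Z p = z"
    using vec_field_through by metis
  note p = in_chart_at[of p]
  have U: "open ?U" using open_chart_domain chart_at_in_atlas by blast
  let ?G = "\<lambda>q. g q (Z q) (Z q)"
  have G: "smooth_fun_on A ?U ?G" using metric_smooth v by blast
  have dG: "differential A ?G q w = 2 * g q (D q w Z) (Z q)" if "q \<in> ?U" for q w
    using metric_compatible[OF v(5,5) that] by (simp add: metric_sym)
  have "differential A (\<lambda>q. differential A ?G q (Y q)) p w
      = 2 * (g p (D p w (\<lambda>q. D q (Y q) Z)) (Z p) + g p (D p (Y p) Z) (D p w Z))" if Y: "Y \<in> vec_fields A ?U" for Y w
  proof -
    note DYZ = connection_vec_field[OF Y v(5)]
    have "differential A (\<lambda>q. differential A ?G q (Y q)) p = differential A (\<lambda>q. 2 * g q (D q (Y q) Z) (Z q)) p"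
      by (rule differential_cong[OF U p dG])
    then show ?thesis using differential_cmult[OF metric_smooth[OF DYZ v(5)] p] metric_compatible[OF DYZ v(5) p] by simp
  qed
  from this[OF v(3)] this[OF v(1)]
  have "2 * g p (D p (lie_bracket A X Y p) Z) (Z p)
     = 2 * g p (D p (X p) (\<lambda>q. D q (Y q) Z)) (Z p) - 2 * g p (D p (Y p) (\<lambda>q. D q (X q) Z)) (Z p)"
    using lie_bracket_commutator[OF v(1,3) p U p G] dG[OF p] metric_sym by (simp add: algebra_simps)
  then have "g p (curvature A D X Y Z p) (Z p) = 0"
    unfolding curvature_def by (simp add: bilinear_lsub[OF metric_bilinear])
  then show ?thesis using curvature_at_eq[OF v(1,3,5) p] v by simp
qed

text \<open>By the Bianchi identity \<open>\<rho>(y,z) - \<rho>(z,y)\<close> is minus the trace of \<open>R(y,z)\<close>, a skew operator.\<close>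
lemma ricci_sym: "ricci A D p y z = ricci A D p z y"
proof -
  have "trace (matrix (\<lambda>x. curvature_at A D p y z x)) = 0"
    using metric by (intro trace_skew_eq_0[OF metric_bilinear _ linear_curvature_at3 curvature_skew])
      (auto simp: pseudo_riemannian_metric_def)
  moreover have "curvature_at A D p x y z - curvature_at A D p x z y = - curvature_at A D p y z x" for x
    using first_bianchi[of p x y z] curvature_at_antisym[of p z x y] by (simp add: algebra_simps eq_neg_iff_add_eq_0)
  then have "curvature_at A D p x y z $ k - curvature_at A D p x z y $ k = - curvature_at A D p y z x $ k" for x k
    by (metis vector_minus_component vector_uminus_component)
  then have "ricci A D p y z - ricci A D p z y = - trace (matrix (\<lambda>x. curvature_at A D p y z x))"
    unfolding ricci_def trace_matrix by (simp add: sum_subtractf[symmetric] sum_negf)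
  ultimately show ?thesis by simp
qed

text \<open>Metric compatibility and vanishing torsion cancel the derivatives of the extending fields, so the
  result depends on their values only.\<close>
lemma lie_derivative_metric:
  assumes V: "V \<in> vec_fields A UNIV"
  shows "lie_derivative A V g p x y = g p (D p x V) y + g p x (D p y V)"
  unfolding lie_derivative_def
proof (rule the_equality)
  show "\<forall>U. \<forall>X\<in>vec_fields A U. \<forall>Y\<in>vec_fields A U.
        p \<in> U \<and> X p = x \<and> Y p = y \<longrightarrow>
        g p (D p x V) y + g p x (D p y V) = differential A (\<lambda>q. g q (X q) (Y q)) p (V p)
            - g p (lie_bracket A V X p) (Y p) - g p (X p) (lie_bracket A V Y p)" (is "\<forall>U. \<forall>X\<in>_. \<forall>Y\<in>_. _ \<longrightarrow> _ = ?L X Y")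
  proof (intro allI ballI impI)
    fix U X Y assume X: "X \<in> vec_fields A U" and Y: "Y \<in> vec_fields A U" and p: "p \<in> U \<and> X p = x \<and> Y p = y"
    have V': "V \<in> vec_fields A U" using vec_fields_subset[OF V vec_fields_open[OF X]] by blast
    show "g p (D p x V) y + g p x (D p y V) = ?L X Y"
      using metric_compatible[OF X Y, of p "V p"] bracket_eq[OF V' X, of p] bracket_eq[OF V' Y, of p] p
      by (simp add: bilinear_lsub[OF metric_bilinear] bilinear_rsub[OF metric_bilinear])
  qed
  fix w assume w: "\<forall>U. \<forall>X\<in>vec_fields A U. \<forall>Y\<in>vec_fields A U.
        p \<in> U \<and> X p = x \<and> Y p = y \<longrightarrow> w = ?L X Y"
  obtain X Y where v: "X \<in> vec_fields A (fst (chart_at A p))" "X p = x" "Y \<in> vec_fields A (fst (chart_at A p))" "Y p = y"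
    using vec_field_through by metis
  note p = in_chart_at[of p]
  have V': "V \<in> vec_fields A (fst (chart_at A p))" using vec_fields_subset[OF V vec_fields_open[OF v(1)]] by blast
  have "w = ?L X Y" using w v p by blast
  then show "w = g p (D p x V) y + g p x (D p y V)"
    using metric_compatible[OF v(1,3) p, of "V p"] bracket_eq[OF V' v(1) p] bracket_eq[OF V' v(3) p] v
    by (simp add: bilinear_lsub[OF metric_bilinear] bilinear_rsub[OF metric_bilinear])
qed

end

context levi_civita_manifold
begin

lemma parallel_scaled_metric:
  assumes h: "\<And>p x y. h p x y = a * g p x y"
  shows "parallel A D h"
  unfolding parallel_def cov_deriv_bilinear_def
  using differential_cmult[OF metric_smooth] metric_compatible by (simp add: h algebra_simps)

end

section \<open>Vertical torse-forming fields\<close>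

locale vertical_torse_forming = levi_civita_manifold A D g "n + 1" n
  for n :: nat and A :: "('m::{t2_space, second_countable_topology}, 'd::finite) chart set" and D and g +
  fixes \<phi> :: "'m \<Rightarrow> real ^ 'd \<Rightarrow> real ^ 'd" and \<xi> :: "'m \<Rightarrow> real ^ 'd" and \<eta> :: "'m \<Rightarrow> real ^ 'd \<Rightarrow> real"
    and \<theta> :: "'m \<Rightarrow> real ^ 'd" and f :: "'m \<Rightarrow> real" and \<gamma> :: "'m \<Rightarrow> real ^ 'd \<Rightarrow> real" and k :: real
  assumes contact: "almost_contact_B_metric_manifold n A \<phi> \<xi> \<eta> g"
    and torse: "torse_forming A D \<theta> f \<gamma>"
    and vertical: "constant_length_vertical \<xi> \<theta> k"
begin

text \<open>This is the conformal scalar of the Reeb field: \<open>\<nabla>\<^sub>x \<xi> = F (x - \<eta>(x) \<xi>)\<close>.\<close>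
definition F :: "'m \<Rightarrow> real" where "F p = f p / k"

lemma k_nonzero: "k \<noteq> 0" and \<theta>_eq: "\<theta> = (\<lambda>p. k *\<^sub>R \<xi> p)"
  using vertical by (auto simp: constant_length_vertical_def)

lemma \<xi>_vec_field: "\<xi> \<in> vec_fields A UNIV"
  and \<phi>_\<xi>: "\<phi> p (\<xi> p) = 0"
  and \<phi>_\<phi>: "\<phi> p (\<phi> p x) = - x + \<eta> p x *\<^sub>R \<xi> p"
  and \<eta>_\<phi>: "\<eta> p (\<phi> p x) = 0"
  and \<eta>_\<xi>: "\<eta> p (\<xi> p) = 1"
  and g_\<phi>_\<phi>: "g p (\<phi> p x) (\<phi> p y) = - g p x y + \<eta> p x * \<eta> p y"
  using contact by (auto simp: almost_contact_B_metric_manifold_def)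

lemma \<phi>_endomorphism: "smooth_endomorphism A \<phi>"
  using contact by (simp add: almost_contact_B_metric_manifold_def)

lemmas g_simps =
  bilinear_ladd[OF metric_bilinear] bilinear_radd[OF metric_bilinear]
  bilinear_lsub[OF metric_bilinear] bilinear_rsub[OF metric_bilinear]
  bilinear_lmul[OF metric_bilinear] bilinear_rmul[OF metric_bilinear]
  bilinear_lneg[OF metric_bilinear] bilinear_rneg[OF metric_bilinear]
  bilinear_lzero[OF metric_bilinear] bilinear_rzero[OF metric_bilinear]

lemma \<eta>_eq_metric: "\<eta> p x = g p x (\<xi> p)"
  using g_\<phi>_\<phi>[of p x "\<xi> p"] by (simp add: \<phi>_\<xi> \<eta>_\<xi> g_simps)

lemma \<eta>_linear: "linear (\<eta> p)"
  using metric_bilinear[of p] by (simp add: \<eta>_eq_metric[abs_def] bilinear_def)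

lemmas \<eta>_simps = linear_add[OF \<eta>_linear] linear_diff[OF \<eta>_linear] linear_scale[OF \<eta>_linear] linear_0[OF \<eta>_linear]

lemma \<xi>_local: "open U \<Longrightarrow> \<xi> \<in> vec_fields A U"
  using vec_fields_subset[OF \<xi>_vec_field] by blast

lemma \<eta>_smooth:
  assumes "X \<in> vec_fields A U"
  shows "smooth_fun_on A U (\<lambda>q. \<eta> q (X q))"
  using metric_smooth[OF assms \<xi>_local[OF vec_fields_open[OF assms]]] by (simp add: \<eta>_eq_metric)

lemma f_smooth: "smooth_fun_on A U f"
  using torse smooth_fun_on_subset[of UNIV f U] by (auto simp: torse_forming_def)

lemma F_eq: "F = (\<lambda>q. (1 / k) * f q)"
  by (simp add: F_def fun_eq_iff)

lemma F_smooth: "open U \<Longrightarrow> smooth_fun_on A U F"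
  unfolding F_eq by (intro smooth_fun_on_mult smooth_fun_on_const f_smooth)

text \<open>Since \<open>\<xi>\<close> has length one, \<open>\<nabla>\<^sub>x \<xi>\<close> is orthogonal to \<open>\<xi>\<close>. This determines the generating form, namely
  \<open>k \<gamma> = - f \<eta>\<close>.\<close>
lemma connection_\<xi>: "D p v \<xi> = F p *\<^sub>R (v - \<eta> p v *\<^sub>R \<xi> p)"
proof -
  have "D p v \<theta> = k *\<^sub>R D p v \<xi>"
    using connection_scale[OF smooth_fun_on_const \<xi>_vec_field UNIV_I] by (simp add: \<theta>_eq differential_const)
  moreover have "D p v \<theta> = f p *\<^sub>R v + \<gamma> p v *\<^sub>R \<theta> p"
    using torse by (simp add: torse_forming_def)
  ultimately have kD: "k *\<^sub>R D p v \<xi> = f p *\<^sub>R v + (k * \<gamma> p v) *\<^sub>R \<xi> p"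
    by (simp add: \<theta>_eq mult.commute)
  have "(\<lambda>q. g q (\<xi> q) (\<xi> q)) = (\<lambda>_. 1)" by (simp add: \<eta>_eq_metric[symmetric] \<eta>_\<xi>)
  then have "g p (D p v \<xi>) (\<xi> p) = 0"
    using metric_compatible[OF \<xi>_vec_field \<xi>_vec_field UNIV_I, of p v] metric_sym[of p "\<xi> p"]
    by (simp add: differential_const)
  then have "g p (k *\<^sub>R D p v \<xi>) (\<xi> p) = 0" by (simp add: g_simps)
  then have "f p * \<eta> p v + k * \<gamma> p v = 0"
    unfolding kD by (simp add: \<eta>_eq_metric[symmetric] \<eta>_simps \<eta>_\<xi>)
  then have "k * \<gamma> p v = - (f p * \<eta> p v)" by simp
  then have "k *\<^sub>R D p v \<xi> = f p *\<^sub>R (v - \<eta> p v *\<^sub>R \<xi> p)"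
    unfolding kD by (simp add: algebra_simps)
  then have "(1 / k) *\<^sub>R (k *\<^sub>R D p v \<xi>) = F p *\<^sub>R (v - \<eta> p v *\<^sub>R \<xi> p)"
    by (simp add: F_def)
  then show ?thesis using k_nonzero by simp
qed

lemma lie_derivative_\<theta>: "lie_derivative A \<theta> g p x y = 2 * (f p * (g p x y - \<eta> p x * \<eta> p y))"
proof -
  have "\<theta> \<in> vec_fields A UNIV" using torse by (simp add: torse_forming_def)
  moreover have "D p v \<theta> = f p *\<^sub>R (v - \<eta> p v *\<^sub>R \<xi> p)" for v
    using connection_scale[OF smooth_fun_on_const \<xi>_vec_field UNIV_I] k_nonzero
    by (simp add: \<theta>_eq differential_const connection_\<xi> F_def)
  moreover have "g p (\<xi> p) y = \<eta> p y" "g p x (\<xi> p) = \<eta> p x"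
    using metric_sym \<eta>_eq_metric by metis+
  ultimately show ?thesis
    by (simp add: lie_derivative_metric g_simps right_diff_distrib)
qed

text \<open>Up to sign this is the eigenvalue of the Jacobi operator \<open>x \<mapsto> R(x,\<xi>)\<xi>\<close> on the complement of \<open>\<xi>\<close>, see
  \<open>curvature_\<xi>_\<xi>\<close>. Regularity says precisely that it vanishes nowhere.\<close>
definition jacobi_factor :: "'m \<Rightarrow> real" where
  "jacobi_factor p = differential A F p (\<xi> p) + (F p)\<^sup>2"

lemma jacobi_factor_eq: "jacobi_factor p = (k * differential A f p (\<xi> p) + (f p)\<^sup>2) / k\<^sup>2"
proof -
  have "differential A F p (\<xi> p) = (1 / k) * differential A f p (\<xi> p)"
    unfolding F_eq by (rule differential_cmult[OF f_smooth[of UNIV] UNIV_I])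
  then show ?thesis
    using k_nonzero by (simp add: jacobi_factor_def F_def field_simps power2_eq_square)
qed

lemma differential_\<eta>:
  assumes X: "X \<in> vec_fields A U" and p: "p \<in> U"
  shows "differential A (\<lambda>q. \<eta> q (X q)) p (\<xi> p) = \<eta> p (D p (\<xi> p) X)"
  using metric_compatible[OF X \<xi>_local[OF vec_fields_open[OF X]] p, of "\<xi> p"]
  by (simp add: \<eta>_eq_metric[symmetric] connection_\<xi> \<eta>_\<xi> g_simps)

text \<open>With \<open>P x = x - \<eta>(x) \<xi>\<close>, differentiating \<open>\<nabla>\<^sub>X \<xi> = F P X\<close> along \<open>\<xi>\<close> gives \<open>dF(\<xi>) P X + F P \<nabla>\<^sub>\<xi> X\<close>, and the
  bracket term contributes \<open>F\<^sup>2 P X - F P \<nabla>\<^sub>\<xi> X\<close> because \<open>P P = P\<close>. The derivatives of \<open>X\<close> cancel.\<close>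
lemma curvature_\<xi>_\<xi>:
  "curvature_at A D p x (\<xi> p) (\<xi> p) = - jacobi_factor p *\<^sub>R (x - \<eta> p x *\<^sub>R \<xi> p)"
proof -
  let ?U = "fst (chart_at A p)"
  obtain X where X: "X \<in> vec_fields A ?U" "X p = x" using vec_field_through by metis
  note p = in_chart_at[of p]
  have U: "open ?U" using open_chart_domain chart_at_in_atlas by blast
  note \<xi> = \<xi>_local[OF U]
  have D0: "D p v (\<lambda>q. 0) = 0" for v
    using connection_add[OF vec_fields_zero[OF U] vec_fields_zero[OF U] p, of v] by simp
  have t1: "D p (X p) (\<lambda>q. D q (\<xi> q) \<xi>) = 0"
    by (simp add: connection_\<xi> \<eta>_\<xi> D0)
  have \<eta>\<xi>: "(\<lambda>q. \<eta> q (X q) *\<^sub>R \<xi> q) \<in> vec_fields A ?U"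
    by (rule vec_fields_scale[OF \<eta>_smooth[OF X(1)] \<xi>])
  have t2: "D p (\<xi> p) (\<lambda>q. D q (X q) \<xi>)
      = differential A F p (\<xi> p) *\<^sub>R (x - \<eta> p x *\<^sub>R \<xi> p)
       + F p *\<^sub>R (D p (\<xi> p) X - \<eta> p (D p (\<xi> p) X) *\<^sub>R \<xi> p)"
    unfolding connection_\<xi>[of _ "X _"]
    by (simp add: connection_scale[OF F_smooth[OF U] vec_fields_diff[OF X(1) \<eta>\<xi>] p]
        connection_diff[OF X(1) \<eta>\<xi> p] connection_scale[OF \<eta>_smooth[OF X(1)] \<xi> p]
        differential_\<eta>[OF X(1) p] connection_\<xi> \<eta>_\<xi> X(2))
  have "curvature A D X \<xi> \<xi> p = - jacobi_factor p *\<^sub>R (x - \<eta> p x *\<^sub>R \<xi> p)"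
    unfolding curvature_eq[OF X(1) \<xi> \<xi> p] t1 t2
    by (simp add: connection_\<xi> \<eta>_simps \<eta>_\<xi> X(2) jacobi_factor_def power2_eq_square algebra_simps)
  then show ?thesis using curvature_at_eq[OF X(1) \<xi> \<xi> p] X(2) by simp
qed

text \<open>The projection along \<open>\<xi>\<close> has rank \<open>2 n\<close>.\<close>
lemma ricci_\<xi>_\<xi>: "ricci A D p (\<xi> p) (\<xi> p) = - (2 * real n) * jacobi_factor p"
proof -
  have "ricci A D p (\<xi> p) (\<xi> p)
      = (\<Sum>i\<in>UNIV. - jacobi_factor p * (1 - \<eta> p (axis i 1) * \<xi> p $ i))"
    unfolding ricci_def trace_matrix curvature_\<xi>_\<xi> by (simp add: axis_def)
  also have "\<dots> = - jacobi_factor p * (real CARD('d) - \<eta> p (\<xi> p))"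
    unfolding sum_distrib_left[symmetric]
    by (simp add: sum_subtractf linear_eq_sum_axis[OF \<eta>_linear, of p "\<xi> p"])
  also have "real CARD('d) = 2 * real n + 1"
    using contact by (simp add: almost_contact_B_metric_manifold_def)
  finally show ?thesis by (simp add: \<eta>_\<xi>)
qed

section \<open>Parallel symmetric tensors\<close>

text \<open>Let \<open>H = h(\<xi>,\<xi>)\<close> and \<open>\<sigma> = h(\<cdot>,\<xi>) - H \<eta>\<close>. Parallelism gives \<open>dH = 2 F \<sigma>\<close>, in particular \<open>dH(\<xi>) = 0\<close>.
  Comparing \<open>\<xi> (X H) - X (\<xi> H)\<close> with \<open>[\<xi>,X] H\<close> yields \<open>2 (dF(\<xi>) + F\<^sup>2) \<sigma> = 0\<close>; this is where regularity
  enters. So \<open>\<sigma> = 0\<close>, \<open>H\<close> is a constant \<open>a\<close>, and \<open>h(Y,\<xi>) = a g(Y,\<xi>)\<close>. Differentiating the last equation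
  once more gives \<open>F (h - a g) = 0\<close>. At a zero of \<open>F\<close> regularity gives \<open>dF(\<xi>) \<noteq> 0\<close>, and the derivative of
  this product along \<open>\<xi>\<close> shows that \<open>h - a g\<close> vanishes there, too.\<close>
lemma parallel_tensor_eq_scaled_metric:
  assumes h: "\<And>p. bilinear (h p)" and h_sym: "\<And>p x y. h p x y = h p y x"
    and h_smooth: "\<And>U X Y. X \<in> vec_fields A U \<Longrightarrow> Y \<in> vec_fields A U \<Longrightarrow> smooth_fun_on A U (\<lambda>q. h q (X q) (Y q))"
    and par: "parallel A D h" and conn: "connected (UNIV :: 'm set)"
    and reg: "\<And>p. jacobi_factor p \<noteq> 0"
  shows "\<exists>a. \<forall>p x y. h p x y = a * g p x y"
proof -
  note h_simps = bilinear_lsub[OF h] bilinear_rsub[OF h] bilinear_lmul[OF h] bilinear_rmul[OF h]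
     bilinear_lzero[OF h] bilinear_rzero[OF h] bilinear_ladd[OF h] bilinear_radd[OF h]
  have compat: "differential A (\<lambda>q. h q (Y q) (Z q)) p v = h p (D p v Y) (Z p) + h p (Y p) (D p v Z)"
    if "Y \<in> vec_fields A U" "Z \<in> vec_fields A U" "p \<in> U" for U Y Z p v
    using par that unfolding parallel_def cov_deriv_bilinear_def by (simp add: algebra_simps)
  define H where "H = (\<lambda>q. h q (\<xi> q) (\<xi> q))"
  define \<sigma> where "\<sigma> = (\<lambda>q v. h q v (\<xi> q) - H q * \<eta> q v)"
  have H: "smooth_fun_on A U H" if "open U" for U
    unfolding H_def using h_smooth \<xi>_local[OF that] by blast
  have \<sigma>_simps: "\<sigma> q (v + w) = \<sigma> q v + \<sigma> q w" "\<sigma> q (v - w) = \<sigma> q v - \<sigma> q w" "\<sigma> q (a *\<^sub>R v) = a * \<sigma> q v" "\<sigma> q (\<xi> q) = 0" for q v w a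
    by (simp_all add: \<sigma>_def H_def h_simps \<eta>_simps \<eta>_\<xi> algebra_simps)
  have dH: "differential A H p v = 2 * F p * \<sigma> p v" for p v
    using compat[OF \<xi>_vec_field \<xi>_vec_field UNIV_I, of p v] h_sym[of p "\<xi> p" v]
    unfolding H_def[symmetric]
    by (simp add: connection_\<xi> h_simps \<sigma>_def algebra_simps) (simp add: H_def algebra_simps)
  have \<sigma>0: "\<sigma> p x = 0" for p x
  proof -
    let ?U = "fst (chart_at A p)"
    obtain X where X: "X \<in> vec_fields A ?U" "X p = x" using vec_field_through by metis
    note p = in_chart_at[of p]
    have U: "open ?U" using open_chart_domain chart_at_in_atlas by blast
    note \<xi> = \<xi>_local[OF U]
    have F2: "smooth_fun_on A ?U (\<lambda>q. 2 * F q)"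
      by (rule smooth_fun_on_mult[OF smooth_fun_on_const F_smooth[OF U] U])
    note h\<xi> = h_smooth[OF X(1) \<xi>] and H\<eta> = smooth_fun_on_mult[OF H[OF U] \<eta>_smooth[OF X(1)] U]
    have "differential A (\<lambda>q. differential A H q (X q)) p (\<xi> p)
        = 2 * F p * \<sigma> p (D p (\<xi> p) X) + 2 * differential A F p (\<xi> p) * \<sigma> p x"
      unfolding dH \<sigma>_def
      using differential_mult[OF F2 smooth_fun_on_diff[OF h\<xi> H\<eta> U] p, of "\<xi> p"]
        differential_cmult[OF F_smooth[OF U] p, of 2 "\<xi> p"]
        differential_diff[OF h\<xi> H\<eta> p, of "\<xi> p"] compat[OF X(1) \<xi> p, of "\<xi> p"]
        differential_mult[OF H[OF U] \<eta>_smooth[OF X(1)] p, of "\<xi> p"]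
        differential_\<eta>[OF X(1) p] dH[of p "\<xi> p"] \<sigma>_simps(4)[of p] X(2)
      by (simp add: connection_\<xi> \<eta>_\<xi> h_simps)
    moreover have "differential A (\<lambda>q. differential A H q (\<xi> q)) p x = 0"
      unfolding dH by (simp add: \<sigma>_simps differential_const)
    moreover have "differential A H p (lie_bracket A \<xi> X p)
        = 2 * F p * \<sigma> p (D p (\<xi> p) X) - 2 * (F p)\<^sup>2 * \<sigma> p x"
      unfolding dH bracket_eq[OF \<xi> X(1) p] connection_\<xi>
      by (simp add: \<sigma>_simps X(2) power2_eq_square algebra_simps)
    ultimately have "2 * jacobi_factor p * \<sigma> p x = 0"
      using lie_bracket_commutator[OF \<xi> X(1) p U p H[OF U]] X(2)
      by (simp add: jacobi_factor_def algebra_simps)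
    then show ?thesis using reg by simp
  qed
  \<comment> \<open>Any point serves to name the constant value of \<open>H\<close>.\<close>
  define a where "a = H undefined"
  have "H p = a" for p
    unfolding a_def by (rule differential_zero_imp_constant[OF H[OF open_UNIV] _ conn]) (simp add: dH \<sigma>0)
  then have h\<xi>: "h p x (\<xi> p) = a * g p x (\<xi> p)" for p x
    using \<sigma>0[of p x] by (simp add: \<sigma>_def \<eta>_eq_metric)
  define K where "K = (\<lambda>p x y. h p x y - a * g p x y)"
  have FK: "F p * K p y v = 0" for p y v
  proof -
    let ?U = "fst (chart_at A p)"
    obtain Y where Y: "Y \<in> vec_fields A ?U" "Y p = y" using vec_field_through by metis
    note p = in_chart_at[of p]
    have U: "open ?U" using open_chart_domain chart_at_in_atlas by blast
    note \<xi> = \<xi>_local[OF U]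
    have "h p (D p v Y) (\<xi> p) + h p y (D p v \<xi>) = a * (g p (D p v Y) (\<xi> p) + g p y (D p v \<xi>))"
      using compat[OF Y(1) \<xi> p, of v] differential_cmult[OF metric_smooth[OF Y(1) \<xi>] p, of a v]
        metric_compatible[OF Y(1) \<xi> p, of v] Y(2) unfolding h\<xi> by (simp add: algebra_simps)
    then show ?thesis
      by (simp add: h\<xi> connection_\<xi> h_simps g_simps K_def algebra_simps)
  qed
  have "K p y z = 0" for p y z
  proof (cases "F p = 0")
    case False
    then show ?thesis using FK[of p y z] by simp
  next
    case True
    let ?U = "fst (chart_at A p)"
    obtain Y Z where Y: "Y \<in> vec_fields A ?U" "Y p = y" and Z: "Z \<in> vec_fields A ?U" "Z p = z"
      using vec_field_through by metis
    note p = in_chart_at[of p]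
    have U: "open ?U" using open_chart_domain chart_at_in_atlas by blast
    have "smooth_fun_on A ?U (\<lambda>q. K q (Y q) (Z q))"
      unfolding K_def
      by (intro smooth_fun_on_diff smooth_fun_on_mult smooth_fun_on_const h_smooth metric_smooth Y Z U)
    from differential_mult[OF F_smooth[OF U] this p, of "\<xi> p"]
    have "differential A F p (\<xi> p) * K p y z = 0"
      unfolding FK differential_const using True Y Z by simp
    then show ?thesis using reg[of p] True by (simp add: jacobi_factor_def)
  qed
  then show ?thesis by (auto simp: K_def)
qed

text \<open>Replacing \<open>y\<close> by \<open>\<phi> y\<close> in the compatibility condition shows that \<open>\<phi>\<close> is self-adjoint, unlike in the
  Riemannian case of contact geometry; this makes the associated metric symmetric.\<close>
lemma g_\<phi>_sym: "g p x (\<phi> p y) = g p (\<phi> p x) y"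
  using g_\<phi>_\<phi>[of p x "\<phi> p y"] by (simp add: \<phi>_\<phi> \<eta>_\<phi> g_simps \<eta>_eq_metric[symmetric])

lemma associated_metric_sym: "associated_metric \<phi> \<eta> g p x y = associated_metric \<phi> \<eta> g p y x"
  using g_\<phi>_sym[of p x y] metric_sym[of p "\<phi> p x" y] by (simp add: associated_metric_def)

lemma associated_metric_bilinear: "bilinear (associated_metric \<phi> \<eta> g p)"
proof -
  have "linear (\<phi> p)" using \<phi>_endomorphism by (simp add: smooth_endomorphism_def)
  then show ?thesis
    unfolding bilinear_def associated_metric_def
    by (auto intro!: linearI simp: g_simps \<eta>_simps linear_add linear_scale algebra_simps)
qed

lemma associated_metric_smooth:
  assumes "X \<in> vec_fields A U" "Y \<in> vec_fields A U"
  shows "smooth_fun_on A U (\<lambda>q. associated_metric \<phi> \<eta> g q (X q) (Y q))"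
proof -
  have U: "open U" using assms vec_fields_open by blast
  have "(\<lambda>q. \<phi> q (Y q)) \<in> vec_fields A U"
    using \<phi>_endomorphism assms(2) U unfolding smooth_endomorphism_def vec_fields_def by blast
  then show ?thesis
    unfolding associated_metric_def
    by (intro smooth_fun_on_add smooth_fun_on_mult metric_smooth \<eta>_smooth assms U)
qed

lemma parallel_iff_scaled_metric:
  assumes h_def: "\<And>p x y. h p x y =
          (1 / 2) * lie_derivative A \<theta> g p x y + ricci A D p x y
          + \<mu> p * associated_metric \<phi> \<eta> g p x y + \<nu> p * (\<eta> p x * \<eta> p y)"
    and \<mu>: "smooth_fun_on A UNIV \<mu>" and \<nu>: "smooth_fun_on A UNIV \<nu>"
    and conn: "connected (UNIV :: 'm set)" and reg: "regular A \<xi> f k"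
  shows "parallel A D h \<longleftrightarrow> (\<exists>a. \<forall>p x y. h p x y = a * g p x y)"
proof
  have h_eq: "h = (\<lambda>p x y. f p * (g p x y - \<eta> p x * \<eta> p y) + ricci A D p x y
          + \<mu> p * associated_metric \<phi> \<eta> g p x y + \<nu> p * (\<eta> p x * \<eta> p y))"
    by (simp add: fun_eq_iff h_def lie_derivative_\<theta>)
  assume "parallel A D h"
  then show "\<exists>a. \<forall>p x y. h p x y = a * g p x y"
  proof (rule parallel_tensor_eq_scaled_metric[rotated 3])
    show "bilinear (h p)" for p
      unfolding h_eq bilinear_def
      by (auto intro!: linearI
         simp: g_simps \<eta>_simps bilinear_ladd[OF ricci_bilinear] bilinear_radd[OF ricci_bilinear]
           bilinear_lmul[OF ricci_bilinear] bilinear_rmul[OF ricci_bilinear]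
           bilinear_ladd[OF associated_metric_bilinear] bilinear_radd[OF associated_metric_bilinear]
           bilinear_lmul[OF associated_metric_bilinear] bilinear_rmul[OF associated_metric_bilinear]
           algebra_simps)
    show "h p x y = h p y x" for p x y
      unfolding h_eq using metric_sym[of p x y] ricci_sym[of p x y] associated_metric_sym[of p x y] by simp
    show "smooth_fun_on A U (\<lambda>q. h q (X q) (Y q))" if X: "X \<in> vec_fields A U" and Y: "Y \<in> vec_fields A U" for U X Y
    proof -
      have U: "open U" using X vec_fields_open by blast
      have \<mu>\<nu>: "smooth_fun_on A U \<mu>" "smooth_fun_on A U \<nu>"
        using \<mu> \<nu> smooth_fun_on_subset by blast+
      show ?thesis
        unfolding h_eq
        by (intro smooth_fun_on_add smooth_fun_on_mult smooth_fun_on_diff f_smooth \<mu>\<nu>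
            metric_smooth \<eta>_smooth ricci_smooth associated_metric_smooth X Y U)
    qed
    show "jacobi_factor p \<noteq> 0" for p
      using reg k_nonzero by (simp add: regular_def jacobi_factor_eq)
  qed (rule conn)
next
  assume "\<exists>a. \<forall>p x y. h p x y = a * g p x y"
  then show "parallel A D h" using parallel_scaled_metric by blast
qed

end

section \<open>The equivalence\<close>

theorem theorem4p2:
  fixes n :: nat
    and A :: "('m::{t2_space, second_countable_topology}, 'd::finite) chart set"
    and \<phi> :: "'m \<Rightarrow> real ^ 'd \<Rightarrow> real ^ 'd"
    and \<xi> :: "'m \<Rightarrow> real ^ 'd"
    and \<eta> :: "'m \<Rightarrow> real ^ 'd \<Rightarrow> real"
    and g :: "'m \<Rightarrow> real ^ 'd \<Rightarrow> real ^ 'd \<Rightarrow> real"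
    and D :: "'m \<Rightarrow> real ^ 'd \<Rightarrow> ('m \<Rightarrow> real ^ 'd) \<Rightarrow> real ^ 'd"
    and \<theta> :: "'m \<Rightarrow> real ^ 'd"
    and f :: "'m \<Rightarrow> real" and \<gamma> :: "'m \<Rightarrow> real ^ 'd \<Rightarrow> real" and k :: real
    and \<mu> \<nu> :: "'m \<Rightarrow> real"
    and h :: "'m \<Rightarrow> real ^ 'd \<Rightarrow> real ^ 'd \<Rightarrow> real"
  assumes "almost_contact_B_metric_manifold n A \<phi> \<xi> \<eta> g"
    and "connected (UNIV :: 'm set)"
    and "levi_civita A g D"
    and "torse_forming A D \<theta> f \<gamma>"
    and "constant_length_vertical \<xi> \<theta> k"
    and "regular A \<xi> f k"
    and "smooth_fun_on A UNIV \<mu>" and "smooth_fun_on A UNIV \<nu>"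
    and h_def: "\<And>p x y. h p x y =
          (1 / 2) * lie_derivative A \<theta> g p x y + ricci A D p x y
          + \<mu> p * associated_metric \<phi> \<eta> g p x y + \<nu> p * (\<eta> p x * \<eta> p y)"
  defines "cond_i \<equiv> parallel A D h"
    and "cond_ii \<equiv> (\<exists>l::real.
          almost_ricci_like_soliton A D \<phi> \<eta> g \<theta> (\<lambda>_. l) \<mu> \<nu> \<and>
          (\<forall>p. l + \<mu> p + \<nu> p =
             2 * real n / k\<^sup>2 * (k * differential A f p (\<xi> p) + (f p)\<^sup>2)))"
    and "cond_iii \<equiv> (\<exists>a b c.
          almost_einstein_like A D \<phi> \<eta> g a b c \<and>
          (\<forall>p. a p + b p + c p =
             - (2 * real n / k\<^sup>2) * (k * differential A f p (\<xi> p) + (f p)\<^sup>2)) \<and>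
          (\<exists>l::real. corresponding_functions f (\<lambda>_. l) \<mu> \<nu> a b c))"
  shows "(cond_i \<longleftrightarrow> cond_ii) \<and> (cond_ii \<longleftrightarrow> cond_iii)"
proof -
  interpret vertical_torse_forming n A D g \<phi> \<xi> \<eta> \<theta> f \<gamma> k
    using assms(1,3,4,5)
    by unfold_locales (auto simp: almost_contact_B_metric_manifold_def levi_civita_def)
  let ?S = "\<lambda>l p. l + \<mu> p + \<nu> p = 2 * real n / k\<^sup>2 * (k * differential A f p (\<xi> p) + (f p)\<^sup>2)"
  have soliton_iff: "almost_ricci_like_soliton A D \<phi> \<eta> g \<theta> (\<lambda>_. l) \<mu> \<nu> \<longleftrightarrow> (\<forall>p x y. h p x y = - l * g p x y)" for l
    unfolding almost_ricci_like_soliton_def h_def by (simp add: eq_neg_iff_add_eq_0 algebra_simps)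
  \<comment> \<open>On \<open>(\<xi>,\<xi>)\<close> the Lie derivative vanishes and both metrics equal \<open>1\<close>, so only \<open>\<rho>(\<xi>,\<xi>)\<close> is left
    against \<open>l + \<mu> + \<nu>\<close>.\<close>
  have constraint: "?S l p" if "\<forall>p x y. h p x y = - l * g p x y" for l p
    using that[rule_format, of p "\<xi> p" "\<xi> p"]
    by (simp add: h_def lie_derivative_\<theta> ricci_\<xi>_\<xi> associated_metric_def \<phi>_\<xi> g_simps
        \<eta>_eq_metric[symmetric] \<eta>_\<xi> jacobi_factor_eq)
  have "cond_i \<longleftrightarrow> (\<exists>a. \<forall>p x y. h p x y = a * g p x y)"
    unfolding cond_i_def by (rule parallel_iff_scaled_metric[OF h_def assms(7,8,2,6)])
  also have "\<dots> \<longleftrightarrow> (\<exists>l. \<forall>p x y. h p x y = - l * g p x y)"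
    by (metis minus_minus)
  also have "\<dots> \<longleftrightarrow> cond_ii"
    unfolding cond_ii_def soliton_iff using constraint by blast
  finally have "cond_i \<longleftrightarrow> cond_ii" .
  moreover have einstein_iff: "almost_einstein_like A D \<phi> \<eta> g a b c \<longleftrightarrow> almost_ricci_like_soliton A D \<phi> \<eta> g \<theta> (\<lambda>_. l) \<mu> \<nu>"
    if "corresponding_functions f (\<lambda>_. l) \<mu> \<nu> a b c" for l a b c
  proof -
    have abc: "a p = - l - f p" "b p = - \<mu> p" "c p = f p - \<nu> p" for p
      using that by (simp_all add: corresponding_functions_def)
    show ?thesis
      unfolding almost_einstein_like_def almost_ricci_like_soliton_def abc lie_derivative_\<theta>
      by (intro iff_allI) (auto simp: algebra_simps)
  qed
  have "cond_ii \<longleftrightarrow> cond_iii"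
  proof
    assume cond_ii
    then obtain l where l: "almost_ricci_like_soliton A D \<phi> \<eta> g \<theta> (\<lambda>_. l) \<mu> \<nu>" "\<forall>p. ?S l p"
      unfolding cond_ii_def by blast
    let ?a = "\<lambda>p. - l - f p" and ?b = "\<lambda>p. - \<mu> p" and ?c = "\<lambda>p. f p - \<nu> p"
    have corr: "corresponding_functions f (\<lambda>_. l) \<mu> \<nu> ?a ?b ?c" by (simp add: corresponding_functions_def)
    have "?a p + ?b p + ?c p = - (2 * real n / k\<^sup>2) * (k * differential A f p (\<xi> p) + (f p)\<^sup>2)" for p
      using l(2)[rule_format, of p] by simp
    then show cond_iii
      unfolding cond_iii_def using einstein_iff[OF corr] l(1) corr by blast
  next
    assume cond_iii
    then obtain a b c l where abc: "almost_einstein_like A D \<phi> \<eta> g a b c"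
      "\<forall>p. a p + b p + c p = - (2 * real n / k\<^sup>2) * (k * differential A f p (\<xi> p) + (f p)\<^sup>2)"
      and corr: "corresponding_functions f (\<lambda>_. l) \<mu> \<nu> a b c"
      unfolding cond_iii_def by blast
    have "?S l p" for p
      using abc(2)[rule_format, of p] corr by (simp add: corresponding_functions_def)
    then show cond_ii
      unfolding cond_ii_def using einstein_iff[OF corr] abc(1) by blast
  qed
  ultimately show ?thesis by blast
qed

end
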